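(* Let $T>0$ and let $c_1,c_2,c_3$ be constants with $c_1>0$, $0<c_2<c_3$, $c_1c_3<1$. Let the coefficients $(b,\sigma,f,g)$ satisfy the standing assumption (A). Assume also that there exists a constant $\varepsilon=\varepsilon(T)>0$ small enough such that $$|\sigma_3|\le c_1,\qquad|h|\le c_2\qquad\text{and}\qquad\overline F(t,c_3)\le\varepsilon,\quad\underline F(t,-c_3)\ge-\varepsilon.$$ Then the dominating ODEs $$\overline{\mathbf y}_t=\overline h+\int_t^T\overline F(s,\overline{\mathbf y}_s)\,ds,\qquad\underline{\mathbf y}_t=\underline h+\int_t^T\underline F(s,\underline{\mathbf y}_s)\,ds,\qquad t\in[0,T],$$ have solutions $\overline{\mathbf y}$ and $\underline{\mathbf y}$ satisfying $-c_3\le\underline{\mathbf y}\le\overline{\mathbf y}\le c_3$; hence, for $\mathbf y=\overline{\mathbf y}$ and $\mathbf y=\underline{\mathbf y}$, both $\mathbf y$ and $(1-\sigma_3\mathbf y)^{-1}$ are bounded.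
   Context: Setting: $B$ is a one-dimensional standard Brownian motion on $(\Omega,\mathcal F,\mathbb P)$ with augmented natural filtration $\mathbb F$. Standing assumption (A): $b,\sigma,f:[0,T]\times\Omega\times\mathbb R^3\to\mathbb R$ are $\mathbb F$-progressively measurable for fixed $(x,y,z)$; $g:\mathbb R\times\Omega\to\mathbb R$ is $\mathcal F_T$-measurable for fixed $x$; $\mathbb E\{(\int_0^T[|b|+|f|](t,0,0,0)dt)^2+\int_0^T|\sigma|^2(t,0,0,0)dt+|g(0)|^2\}<\infty$; and $b,\sigma,f,g$ are uniformly Lipschitz in the spatial variables, uniformly in $(t,\omega)$, with common Lipschitz constant $K_0>0$. Difference quotients: for $\theta_j=(x_j,y_j,z_j)\in\mathbb R^3$, $j=1,2$, and $\varphi\in\{b,\sigma,f\}$, $$h=\tfrac{g(x_1)-g(x_2)}{x_1-x_2},\quad\varphi_1=\tfrac{\varphi(t,x_1,y_1,z_1)-\varphi(t,x_2,y_1,z_1)}{x_1-x_2},\quad\varphi_2=\tfrac{\varphi(t,x_2,y_1,z_1)-\varphi(t,x_2,y_2,z_1)}{y_1-y_2},\quad\varphi_3=\tfrac{\varphi(t,x_2,y_2,z_1)-\varphi(t,x_2,y_2,z_2)}{z_1-z_2}$$ (a quotient $\frac{\psi(x)-\psi(x)}{x-x}$ is understood as $\liminf_{\tilde x\to x}\frac{\psi(\tilde x)-\psi(x)}{\tilde x-x}$). Inequalities imposed on $h,b_i,\sigma_i,f_i$ are required to hold uniformly for all $\theta_1,\theta_2$ (and all $(t,\omega)$); inequalities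 on $\overline F(t,\cdot),\underline F(t,\cdot)$ are for all $t\in[0,T]$. Define $$F(\theta_1,\theta_2;t,y)=f_1+f_2y+y(b_1+b_2y)+\frac{(f_3+b_3y)y(\sigma_1+\sigma_2y)}{1-\sigma_3y},$$ and the deterministic quantities $$\overline h=\operatorname{esssup}\Big(\sup_{x_1\ne x_2}h\Big),\quad\underline h=\operatorname{essinf}\Big(\inf_{x_1\ne x_2}h\Big),\quad\overline F(t,y)=\operatorname{esssup}\Big(\sup F(\theta_1,\theta_2;t,y)\Big),\quad\underline F(t,y)=\operatorname{essinf}\Big(\inf F(\theta_1,\theta_2;t,y)\Big),$$ the last sup and inf over $x_1\ne x_2,y_1\neq y_2,z_1\ne z_2$, and esssup/essinf over $\omega$. *)

theory Defs
  imports "HOL-Probability.Probability"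
begin

type_synonym 'w coeff = "real \<Rightarrow> 'w \<Rightarrow> real \<times> real \<times> real \<Rightarrow> real"

definition brownian_motion :: "'w measure \<Rightarrow> (real \<Rightarrow> 'w \<Rightarrow> real) \<Rightarrow> bool" where
  "brownian_motion M B \<longleftrightarrow>
     prob_space M \<and>
     (\<forall>t\<ge>0. B t \<in> borel_measurable M) \<and>
     (AE \<omega> in M. B 0 \<omega> = 0) \<and>
     (AE \<omega> in M. continuous_on {0..} (\<lambda>t. B t \<omega>)) \<and>
     (\<forall>s t. 0 \<le> s \<longrightarrow> s < t \<longrightarrow>
        distributed M lborel (\<lambda>\<omega>. B t \<omega> - B s \<omega>) (\<lambda>x. ennreal (normal_density 0 (sqrt (t - s)) x))) \<and>
     (\<forall>(n::nat) \<tau>. 0 \<le> \<tau> 0 \<longrightarrow> (\<forall>i<n. \<tau> i < \<tau> (Suc i)) \<longrightarrow>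
        prob_space.indep_vars M (\<lambda>_. borel) (\<lambda>i \<omega>. B (\<tau> (Suc i)) \<omega> - B (\<tau> i) \<omega>) {..<n})"

definition augmented_filtration :: "'w measure \<Rightarrow> (real \<Rightarrow> 'w \<Rightarrow> real) \<Rightarrow> real \<Rightarrow> 'w measure" where
  "augmented_filtration M B t =
     sigma (space M)
       ({B s -` A \<inter> space M | s A. s \<in> {0..t} \<and> A \<in> sets borel} \<union> null_sets M)"

definition progressively_measurable ::
  "real \<Rightarrow> (real \<Rightarrow> 'w measure) \<Rightarrow> (real \<Rightarrow> 'w \<Rightarrow> real) \<Rightarrow> bool" where
  "progressively_measurable T \<F> X \<longleftrightarrow>
     (\<forall>t\<in>{0..T}. (\<lambda>(s, \<omega>). X s \<omega>) \<in> borel_measurable (restrict_space borel {0..t} \<Otimes>\<^sub>M \<F> t))"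

text \<open>The Lipschitz condition uses the Euclidean distance, which is the library's distance on
  \<^typ>\<open>real \<times> real \<times> real\<close>.\<close>

definition standing_assumption ::
  "real \<Rightarrow> real \<Rightarrow> 'w measure \<Rightarrow> (real \<Rightarrow> 'w \<Rightarrow> real) \<Rightarrow>
   'w coeff \<Rightarrow> 'w coeff \<Rightarrow> 'w coeff \<Rightarrow> (real \<Rightarrow> 'w \<Rightarrow> real) \<Rightarrow> bool" where
  "standing_assumption T K\<^sub>0 M B b \<sigma> f g \<longleftrightarrow>
     (\<forall>\<theta>. progressively_measurable T (augmented_filtration M B) (\<lambda>t \<omega>. b t \<omega> \<theta>) \<and>
          progressively_measurable T (augmented_filtration M B) (\<lambda>t \<omega>. \<sigma> t \<omega> \<theta>) \<and>
          progressively_measurable T (augmented_filtration M B) (\<lambda>t \<omega>. f t \<omega> \<theta>)) \<and>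
     (\<forall>x. g x \<in> borel_measurable (augmented_filtration M B T)) \<and>
     (\<integral>\<^sup>+\<omega>. ((\<integral>\<^sup>+t\<in>{0..T}. ennreal (\<bar>b t \<omega> (0, 0, 0)\<bar> + \<bar>f t \<omega> (0, 0, 0)\<bar>) \<partial>lborel)\<^sup>2
            + (\<integral>\<^sup>+t\<in>{0..T}. ennreal (\<bar>\<sigma> t \<omega> (0, 0, 0)\<bar>\<^sup>2) \<partial>lborel)
            + ennreal (\<bar>g 0 \<omega>\<bar>\<^sup>2)) \<partial>M) < \<infinity> \<and>
     (\<forall>t\<in>{0..T}. \<forall>\<omega>\<in>space M.
        K\<^sub>0-lipschitz_on UNIV (b t \<omega>) \<and> K\<^sub>0-lipschitz_on UNIV (\<sigma> t \<omega>) \<and> K\<^sub>0-lipschitz_on UNIV (f t \<omega>)) \<and>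
     (\<forall>\<omega>\<in>space M. K\<^sub>0-lipschitz_on UNIV (\<lambda>x. g x \<omega>))"

text \<open>On the diagonal the quotient is the lower limit of the difference quotients, which is finite
  for Lipschitz functions, so that \<^const>\<open>real_of_ereal\<close> loses nothing.\<close>

definition diff_quot :: "(real \<Rightarrow> real) \<Rightarrow> real \<Rightarrow> real \<Rightarrow> real" where
  "diff_quot \<psi> u v =
     (if u \<noteq> v then (\<psi> u - \<psi> v) / (u - v)
      else real_of_ereal (Liminf (at v) (\<lambda>w. ereal ((\<psi> w - \<psi> v) / (w - v)))))"

fun dq1 dq2 dq3 ::
  "(real \<times> real \<times> real \<Rightarrow> real) \<Rightarrow> real \<times> real \<times> real \<Rightarrow> real \<times> real \<times> real \<Rightarrow> real" where
  "dq1 \<phi> (x\<^sub>1, y\<^sub>1, z\<^sub>1) (x\<^sub>2, y\<^sub>2, z\<^sub>2) = diff_quot (\<lambda>x. \<phi> (x, y\<^sub>1, z\<^sub>1)) x\<^sub>1 x\<^sub>2"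
| "dq2 \<phi> (x\<^sub>1, y\<^sub>1, z\<^sub>1) (x\<^sub>2, y\<^sub>2, z\<^sub>2) = diff_quot (\<lambda>y. \<phi> (x\<^sub>2, y, z\<^sub>1)) y\<^sub>1 y\<^sub>2"
| "dq3 \<phi> (x\<^sub>1, y\<^sub>1, z\<^sub>1) (x\<^sub>2, y\<^sub>2, z\<^sub>2) = diff_quot (\<lambda>z. \<phi> (x\<^sub>2, y\<^sub>2, z)) z\<^sub>1 z\<^sub>2"

definition F_fun ::
  "'w coeff \<Rightarrow> 'w coeff \<Rightarrow> 'w coeff \<Rightarrow> real \<times> real \<times> real \<Rightarrow> real \<times> real \<times> real \<Rightarrow>
   real \<Rightarrow> 'w \<Rightarrow> real \<Rightarrow> real" where
  "F_fun b \<sigma> f \<theta>\<^sub>1 \<theta>\<^sub>2 t \<omega> y =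
     (let b\<^sub>1 = dq1 (b t \<omega>) \<theta>\<^sub>1 \<theta>\<^sub>2; b\<^sub>2 = dq2 (b t \<omega>) \<theta>\<^sub>1 \<theta>\<^sub>2; b\<^sub>3 = dq3 (b t \<omega>) \<theta>\<^sub>1 \<theta>\<^sub>2;
          \<sigma>\<^sub>1 = dq1 (\<sigma> t \<omega>) \<theta>\<^sub>1 \<theta>\<^sub>2; \<sigma>\<^sub>2 = dq2 (\<sigma> t \<omega>) \<theta>\<^sub>1 \<theta>\<^sub>2; \<sigma>\<^sub>3 = dq3 (\<sigma> t \<omega>) \<theta>\<^sub>1 \<theta>\<^sub>2;
          f\<^sub>1 = dq1 (f t \<omega>) \<theta>\<^sub>1 \<theta>\<^sub>2; f\<^sub>2 = dq2 (f t \<omega>) \<theta>\<^sub>1 \<theta>\<^sub>2; f\<^sub>3 = dq3 (f t \<omega>) \<theta>\<^sub>1 \<theta>\<^sub>2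
      in f\<^sub>1 + f\<^sub>2 * y + y * (b\<^sub>1 + b\<^sub>2 * y)
         + (f\<^sub>3 + b\<^sub>3 * y) * y * (\<sigma>\<^sub>1 + \<sigma>\<^sub>2 * y) / (1 - \<sigma>\<^sub>3 * y))"

definition essinf :: "'w measure \<Rightarrow> ('w \<Rightarrow> ereal) \<Rightarrow> ereal" where
  "essinf M X = - esssup M (\<lambda>\<omega>. - X \<omega>)"

definition distinct_pairs :: "(real \<times> real) set" where
  "distinct_pairs = {(x\<^sub>1, x\<^sub>2). x\<^sub>1 \<noteq> x\<^sub>2}"

definition distinct_triples :: "((real \<times> real \<times> real) \<times> (real \<times> real \<times> real)) set" where
  "distinct_triples = {((x\<^sub>1, y\<^sub>1, z\<^sub>1), (x\<^sub>2, y\<^sub>2, z\<^sub>2)). x\<^sub>1 \<noteq> x\<^sub>2 \<and> y\<^sub>1 \<noteq> y\<^sub>2 \<and> z\<^sub>1 \<noteq> z\<^sub>2}"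

definition h_upper :: "'w measure \<Rightarrow> (real \<Rightarrow> 'w \<Rightarrow> real) \<Rightarrow> ereal" where
  "h_upper M g =
     esssup M (\<lambda>\<omega>. SUP (x\<^sub>1, x\<^sub>2)\<in>distinct_pairs. ereal (diff_quot (\<lambda>x. g x \<omega>) x\<^sub>1 x\<^sub>2))"

definition h_lower :: "'w measure \<Rightarrow> (real \<Rightarrow> 'w \<Rightarrow> real) \<Rightarrow> ereal" where
  "h_lower M g =
     essinf M (\<lambda>\<omega>. INF (x\<^sub>1, x\<^sub>2)\<in>distinct_pairs. ereal (diff_quot (\<lambda>x. g x \<omega>) x\<^sub>1 x\<^sub>2))"

definition F_upper ::
  "'w measure \<Rightarrow> 'w coeff \<Rightarrow> 'w coeff \<Rightarrow> 'w coeff \<Rightarrow> real \<Rightarrow> real \<Rightarrow> ereal" where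
  "F_upper M b \<sigma> f t y =
     esssup M (\<lambda>\<omega>. SUP (\<theta>\<^sub>1, \<theta>\<^sub>2)\<in>distinct_triples. ereal (F_fun b \<sigma> f \<theta>\<^sub>1 \<theta>\<^sub>2 t \<omega> y))"

definition F_lower ::
  "'w measure \<Rightarrow> 'w coeff \<Rightarrow> 'w coeff \<Rightarrow> 'w coeff \<Rightarrow> real \<Rightarrow> real \<Rightarrow> ereal" where
  "F_lower M b \<sigma> f t y =
     essinf M (\<lambda>\<omega>. INF (\<theta>\<^sub>1, \<theta>\<^sub>2)\<in>distinct_triples. ereal (F_fun b \<sigma> f \<theta>\<^sub>1 \<theta>\<^sub>2 t \<omega> y))"

text \<open>The data are extended-real valued; a solution is required to stay where they are finite, so
  that the conversions to \<^typ>\<open>real\<close> are genuine.\<close>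

definition ode_solution :: "real \<Rightarrow> ereal \<Rightarrow> (real \<Rightarrow> real \<Rightarrow> ereal) \<Rightarrow> (real \<Rightarrow> real) \<Rightarrow> bool" where
  "ode_solution T h \<Phi> y \<longleftrightarrow>
     \<bar>h\<bar> \<noteq> \<infinity> \<and>
     (\<forall>s\<in>{0..T}. \<bar>\<Phi> s (y s)\<bar> \<noteq> \<infinity>) \<and>
     set_integrable lborel {0..T} (\<lambda>s. real_of_ereal (\<Phi> s (y s))) \<and>
     (\<forall>t\<in>{0..T}. y t = real_of_ereal h + (LBINT s:{t..T}. real_of_ereal (\<Phi> s (y s))))"

text \<open>The condition that \<open>1 - \<sigma>\<^sub>3 y\<close> does not vanish is explicit because \<open>inverse 0 = 0\<close>.\<close>

definition bounded_with_inverse ::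
  "real \<Rightarrow> 'w measure \<Rightarrow> 'w coeff \<Rightarrow> (real \<Rightarrow> real) \<Rightarrow> bool" where
  "bounded_with_inverse T M \<sigma> y \<longleftrightarrow>
     bounded (y ` {0..T}) \<and>
     (\<exists>C. \<forall>t\<in>{0..T}. \<forall>\<omega>\<in>space M. \<forall>\<theta>\<^sub>1 \<theta>\<^sub>2.
        1 - dq3 (\<sigma> t \<omega>) \<theta>\<^sub>1 \<theta>\<^sub>2 * y t \<noteq> 0 \<and> \<bar>inverse (1 - dq3 (\<sigma> t \<omega>) \<theta>\<^sub>1 \<theta>\<^sub>2 * y t)\<bar> \<le> C)"

end

theory Submission
  imports Defs
begin

text \<open>
  On \<open>[-c\<^sub>3, c\<^sub>3]\<close> the denominator \<open>1 - \<sigma>\<^sub>3 y\<close> is at least \<open>1 - c\<^sub>1 c\<^sub>3 > 0\<close>, so \<open>F\<close> is bounded and Lipschitz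
  in \<open>y\<close> with a constant \<open>L\<close> depending only on \<open>K\<^sub>0, c\<^sub>1, c\<^sub>3\<close>, and both properties pass to the
  essential supremum and infimum. After clamping \<open>y\<close> to \<open>[-c\<^sub>3, c\<^sub>3]\<close> the dominating equations are
  Caratheodory equations with globally Lipschitz right-hand side, solvable by a contraction in an
  exponentially weighted norm. Comparison with the barrier \<open>c\<^sub>3 - (c\<^sub>3 - c\<^sub>2) exp (- 2 L (T - t))\<close> keeps
  the upper solution below \<open>c\<^sub>3\<close> as soon as \<open>\<epsilon> \<le> L (c\<^sub>3 - c\<^sub>2) exp (- 2 L T)\<close>; the lower equation
  is the upper one for \<open>- F(-y)\<close>. Comparing the two solutions with each other shows that both stay
  in \<open>[-c\<^sub>3, c\<^sub>3]\<close>, where the clamping is inactive.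
\<close>

section \<open>Comparison for backward integral equations\<close>

text \<open>The rate takes both signs below: \<open>2 * L\<close> gives the weights in the
  comparison and contraction arguments, \<open>- (2 * L)\<close> gives the barrier.\<close>

lemma integral_exp_backward:
  fixes \<kappa> t T :: real
  assumes "\<kappa> \<noteq> 0" "t \<le> T"
  shows "((\<lambda>s. exp (\<kappa> * (T - s))) has_integral (exp (\<kappa> * (T - t)) - 1) / \<kappa>) {t..T}"
proof -
  have "((\<lambda>s. exp (\<kappa> * (T - s))) has_integral
          (- exp (\<kappa> * (T - T)) / \<kappa> - (- exp (\<kappa> * (T - t)) / \<kappa>))) {t..T}"
    by (rule fundamental_theorem_of_calculus)
      (use assms in \<open>auto intro!: derivative_eq_intros
         simp: has_real_derivative_iff_has_vector_derivative[symmetric]\<close>)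
  then show ?thesis by (simp add: diff_divide_distrib)
qed

text \<open>A Gronwall argument without derivatives, since \<open>k\<close> is merely integrable. If
  \<open>w\<close> were negative somewhere, its exponentially weighted negative part would have a
  positive maximum at some \<open>t\<close>; between \<open>t\<close> and the next zero of
  \<open>w\<close> the integral of \<open>k\<close> is too small in size to make up for
  \<open>w t\<close>.\<close>

lemma backward_integral_comparison:
  fixes w k :: "real \<Rightarrow> real" and L T w\<^sub>0 :: real
  assumes L: "0 < L" and T: "0 \<le> T" and k: "k integrable_on {0..T}"
    and w: "\<And>t. t \<in> {0..T} \<Longrightarrow> w t = w\<^sub>0 + integral {t..T} k"
    and w\<^sub>0: "0 \<le> w\<^sub>0"
    and kw: "\<And>s. s \<in> {0..T} \<Longrightarrow> - (L * \<bar>w s\<bar>) \<le> k s"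
    and r: "r \<in> {0..T}"
  shows "0 \<le> w r"
proof (rule ccontr)
  assume neg: "\<not> 0 \<le> w r"
  have contw: "continuous_on {0..T} w"
  proof -
    have "continuous_on {0..T} (\<lambda>t. w\<^sub>0 + integral {t..T} k)"
      by (intro continuous_intros indefinite_integral_continuous_1' k)
    then show ?thesis by (rule continuous_on_eq) (simp add: w)
  qed
  \<comment> \<open>The rate is \<open>2 * L\<close> because integrating the inverse weight then
    produces \<open>1 / (2 * L)\<close>: the factor \<open>L\<close> from \<open>kw\<close> turns
    into one half, which makes the last estimate strict.\<close>
  define q where "q s = exp (- (2 * L * (T - s))) * max 0 (- w s)" for s
  have "continuous_on {0..T} q"
    unfolding q_def by (intro continuous_intros contw)
  then obtain t where t: "t \<in> {0..T}" and qmax: "\<And>s. s \<in> {0..T} \<Longrightarrow> q s \<le> q t"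
    using continuous_attains_sup[of "{0..T}" q] T by fastforce
  have "0 < q r" unfolding q_def by (rule mult_pos_pos) (use neg in auto)
  then have qpos: "0 < q t" using qmax[OF r] by linarith
  then have wt: "w t < 0" by (auto simp: q_def zero_less_mult_iff max_def split: if_splits)
  have wT: "0 \<le> w T" using w[of T] w\<^sub>0 T by simp
  \<comment> \<open>Compactness of \<open>Z\<close> provides a first zero \<tau> after
    \<open>t\<close>, before which \<open>w\<close> cannot change sign.\<close>
  define Z where "Z = {s \<in> {t..T}. w s = 0}"
  have cont_sub: "continuous_on {a..b} w" if "0 \<le> a" "b \<le> T" for a b
    using contw by (rule continuous_on_subset) (use that in auto)
  have "compact Z"
  proof -
    have "closed Z" unfolding Z_def
      by (rule continuous_closed_preimage_constant) (use t in \<open>auto intro: cont_sub\<close>)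
    moreover have "bounded Z" by (rule bounded_subset[of "{t..T}"]) (auto simp: Z_def)
    ultimately show ?thesis by (simp add: compact_eq_bounded_closed)
  qed
  moreover have "Z \<noteq> {}"
    using IVT'[of w t 0 T] wt wT t cont_sub[of t T] by (fastforce simp: Z_def)
  ultimately obtain \<tau> where \<tau>: "\<tau> \<in> Z" and \<tau>min: "\<And>s. s \<in> Z \<Longrightarrow> \<tau> \<le> s"
    using compact_attains_inf[of Z] by blast
  have \<tau>': "t \<le> \<tau>" "\<tau> \<le> T" "w \<tau> = 0" using \<tau> by (auto simp: Z_def)
  have neg_before: "w s \<le> 0" if s: "s \<in> {t..\<tau>}" for s
  proof (rule ccontr)
    assume "\<not> w s \<le> 0"
    then obtain s' where s': "t \<le> s'" "s' \<le> s" "w s' = 0"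
      using IVT'[of w t 0 s] wt s \<tau>' t cont_sub[of t s] by fastforce
    then have "s' \<in> Z" using s \<tau>' by (auto simp: Z_def)
    then have "s = \<tau>" using \<tau>min s' s by fastforce
    with \<open>\<not> w s \<le> 0\<close> \<tau>' show False by simp
  qed
  have kint: "k integrable_on {a..b}" if "0 \<le> a" "b \<le> T" for a b
    using k by (rule integrable_on_subinterval) (use that in auto)
  have E: "((\<lambda>s. exp (2 * L * (T - s))) has_integral (exp (2 * L * (T - a)) - 1) / (2 * L)) {a..T}"
    if "a \<le> T" for a using integral_exp_backward[of "2 * L" a T] L that by simp
  have eint: "(\<lambda>s. exp (2 * L * (T - s))) integrable_on {t..\<tau>}"
    by (intro integrable_continuous_real continuous_intros)
  have "- (L * q t * integral {t..\<tau>} (\<lambda>s. exp (2 * L * (T - s))))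
      = integral {t..\<tau>} (\<lambda>s. - (L * q t) * exp (2 * L * (T - s)))"
    by simp
  also have "\<dots> \<le> integral {t..\<tau>} k"
  proof (rule integral_le)
    show "(\<lambda>s. - (L * q t) * exp (2 * L * (T - s))) integrable_on {t..\<tau>}"
      by (intro integrable_continuous_real continuous_intros)
    show "k integrable_on {t..\<tau>}" using kint t \<tau>' by simp
    fix s assume s: "s \<in> {t..\<tau>}"
    then have s0: "s \<in> {0..T}" using t \<tau>' by auto
    have "\<bar>w s\<bar> = exp (2 * L * (T - s)) * q s"
      using neg_before[OF s] by (simp add: q_def mult.assoc[symmetric] exp_add[symmetric])
    also have "\<dots> \<le> exp (2 * L * (T - s)) * q t" using qmax[OF s0] by simp
    finally have "L * \<bar>w s\<bar> \<le> L * (exp (2 * L * (T - s)) * q t)" using L by simp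
    then show "- (L * q t) * exp (2 * L * (T - s)) \<le> k s"
      using kw[OF s0] by (simp add: mult_ac)
  qed
  \<comment> \<open>Since \<open>w \<tau> = 0\<close>, the terminal value and the integral beyond
    \<tau> cancel.\<close>
  also have "integral {t..\<tau>} k = w t"
  proof -
    have "integral {t..T} k = integral {t..\<tau>} k + integral {\<tau>..T} k"
      using Henstock_Kurzweil_Integration.integral_combine[of t \<tau> T k] kint[of t T] \<tau>' t by simp
    then show ?thesis using w[of t] w[of \<tau>] \<tau>' t by simp
  qed
  finally have "- w t \<le> L * q t * integral {t..\<tau>} (\<lambda>s. exp (2 * L * (T - s)))" by simp
  also have "\<dots> \<le> L * q t * integral {t..T} (\<lambda>s. exp (2 * L * (T - s)))"
    using L qpos \<tau>' eint E[of t] t by (intro mult_left_mono integral_subset_le) auto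
  also have "\<dots> = L * q t * ((exp (2 * L * (T - t)) - 1) / (2 * L))"
    using integral_unique[OF E[of t]] t by simp
  also have "\<dots> < q t * exp (2 * L * (T - t))"
  proof -
    have "L * q t * ((x - 1) / (2 * L)) < q t * x" if "0 < x" for x
    proof -
      have "q t * ((x - 1) / 2) < q t * x" using that qpos by (intro mult_strict_left_mono) auto
      then show ?thesis using L by simp
    qed
    from this[OF exp_gt_zero] show ?thesis .
  qed
  also have "\<dots> = - w t"
    using wt by (simp add: q_def mult.commute mult.left_commute exp_add[symmetric] flip: mult.assoc)
  finally show False by simp
qed

section \<open>Existence for backward Caratheodory equations\<close>

text \<open>Rounding \<open>z\<close> down to multiples of \<open>1 / Suc n\<close> leaves countably
  many sections of \<Phi>, so the rounded composition is measurable; the Lipschitz condition carries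
  this to the limit.\<close>

lemma measurable_lipschitz_compose:
  fixes \<Phi> :: "real \<Rightarrow> real \<Rightarrow> real"
  assumes m: "\<And>y. (\<lambda>s. \<Phi> s y) \<in> borel_measurable borel"
    and lip: "\<And>s y y'. \<bar>\<Phi> s y - \<Phi> s y'\<bar> \<le> L * \<bar>y - y'\<bar>"
    and [measurable]: "z \<in> borel_measurable borel"
  shows "(\<lambda>s. \<Phi> s (z s)) \<in> borel_measurable borel"
proof (rule borel_measurable_LIMSEQ_real)
  let ?r = "\<lambda>(n::nat) s. real_of_int \<lfloor>real (Suc n) * z s\<rfloor> / real (Suc n)"
  fix n
  have "(\<lambda>s. (\<lambda>i s. \<Phi> s (real_of_int i / real (Suc n))) \<lfloor>real (Suc n) * z s\<rfloor> s) \<in> borel_measurable borel"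
    by (rule measurable_compose_countable[where f = "\<lambda>i s. \<Phi> s (real_of_int i / real (Suc n))"])
      (rule m, measurable)
  then show "(\<lambda>s. \<Phi> s (?r n s)) \<in> borel_measurable borel" by simp
next
  let ?r = "\<lambda>(n::nat) s. real_of_int \<lfloor>real (Suc n) * z s\<rfloor> / real (Suc n)"
  fix s
  have close: "\<bar>?r n s - z s\<bar> \<le> inverse (real (Suc n))" for n
  proof -
    have "\<bar>real_of_int \<lfloor>x\<rfloor> - x\<bar> \<le> 1" for x :: real by linarith
    then have "\<bar>real_of_int \<lfloor>real (Suc n) * z s\<rfloor> - real (Suc n) * z s\<bar> \<le> 1" .
    moreover have "?r n s - z s = (real_of_int \<lfloor>real (Suc n) * z s\<rfloor> - real (Suc n) * z s) / real (Suc n)"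
      by (simp add: diff_divide_distrib del: of_nat_Suc)
    ultimately show ?thesis
      by (simp only: inverse_eq_divide abs_divide abs_of_nat divide_right_mono of_nat_0_le_iff)
  qed
  have lim: "(\<lambda>n. \<bar>L\<bar> * inverse (real (Suc n))) \<longlonglongrightarrow> 0"
    by (rule tendsto_mult_right_zero[OF LIMSEQ_inverse_real_of_nat])
  have "\<bar>\<Phi> s (?r n s) - \<Phi> s (z s)\<bar> \<le> \<bar>L\<bar> * inverse (real (Suc n))" for n
  proof -
    have "\<bar>\<Phi> s (?r n s) - \<Phi> s (z s)\<bar> \<le> L * \<bar>?r n s - z s\<bar>" by (rule lip)
    also have "\<dots> \<le> \<bar>L\<bar> * \<bar>?r n s - z s\<bar>" by (intro mult_right_mono) auto
    also have "\<dots> \<le> \<bar>L\<bar> * inverse (real (Suc n))" by (intro mult_left_mono close) auto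
    finally show ?thesis .
  qed
  then have "(\<lambda>n. \<Phi> s (?r n s) - \<Phi> s (z s)) \<longlonglongrightarrow> 0"
    by (intro Lim_null_comparison[OF _ lim] always_eventually allI) (simp only: real_norm_def)
  then show "(\<lambda>n. \<Phi> s (?r n s)) \<longlonglongrightarrow> \<Phi> s (z s)" by (rule LIM_zero_cancel)
qed

lemma set_integrable_bounded_interval:
  fixes k :: "real \<Rightarrow> real"
  assumes "k \<in> borel_measurable borel" "\<And>s. \<bar>k s\<bar> \<le> C"
  shows "set_integrable lborel {a..b} k"
  unfolding set_integrable_def
  by (rule integrableI_bounded_set_indicator[where B = C])
    (use assms in \<open>auto simp: emeasure_lborel_Icc_eq\<close>)

text \<open>The unknown is written as \<open>e\<close> times a bounded continuous \<open>z\<close>,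
  so that the uniform distance of the \<open>z\<close> is the exponentially weighted distance of the
  solutions. In it the integral operator contracts by one half, and Banach's theorem applies on the
  whole interval at once.\<close>

lemma backward_caratheodory_existence:
  fixes \<Phi> :: "real \<Rightarrow> real \<Rightarrow> real"
  assumes T: "0 \<le> T" and L: "0 < L"
    and m: "\<And>y. (\<lambda>s. \<Phi> s y) \<in> borel_measurable borel"
    and bd: "\<And>s y. \<bar>\<Phi> s y\<bar> \<le> C"
    and lip: "\<And>s y y'. \<bar>\<Phi> s y - \<Phi> s y'\<bar> \<le> L * \<bar>y - y'\<bar>"
  obtains y where "set_integrable lborel {0..T} (\<lambda>s. \<Phi> s (y s))"
    and "\<And>t. t \<in> {0..T} \<Longrightarrow> y t = h + (LBINT s:{t..T}. \<Phi> s (y s))"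
proof -
  define e where "e t = exp (2 * L * (T - t))" for t
  define k where "k z s = \<Phi> s (e s * apply_bcontfun z s)" for z :: "real \<Rightarrow>\<^sub>C real" and s
  \<comment> \<open>Freezing time outside \<open>{0..T}\<close> makes \<open>G z\<close> bounded and
    continuous on the whole line, hence a member of the complete space of bounded continuous
    functions.\<close>
  define cl where "cl t = max 0 (min T t)" for t
  define G where "G z t = (h + integral {cl t..T} (k z)) / e (cl t)" for z t
  have e: "0 < e t" "e t \<noteq> 0" for t by (auto simp: e_def)
  have e_cont: "continuous_on A e" for A unfolding e_def by (intro continuous_intros)
  have cl: "cl t \<in> {0..T}" for t using T by (auto simp: cl_def)
  have cl_id: "cl t = t" if "t \<in> {0..T}" for t using that by (auto simp: cl_def)
  have k_meas: "k z \<in> borel_measurable borel" for z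
  proof -
    have "(\<lambda>s. e s * apply_bcontfun z s) \<in> borel_measurable borel"
      by (intro borel_measurable_continuous_onI continuous_intros e_cont) auto
    then show ?thesis unfolding k_def by (rule measurable_lipschitz_compose[OF m lip])
  qed
  have k_set: "set_integrable lborel {a..b} (k z)" for a b z
    by (rule set_integrable_bounded_interval[where C = C]) (use k_meas bd in \<open>auto simp: k_def\<close>)
  note k_int = set_borel_integral_eq_integral[OF k_set]
  have G_mem: "G z \<in> bcontfun" for z
  proof -
    have c0: "continuous_on {0..T} (\<lambda>t. (h + integral {t..T} (k z)) / e t)"
      using e by (intro continuous_intros indefinite_integral_continuous_1' e_cont k_int) auto
    then have "bounded ((\<lambda>t. (h + integral {t..T} (k z)) / e t) ` {0..T})"
      by (intro compact_imp_bounded compact_continuous_image) auto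
    moreover have "range (G z) \<subseteq> (\<lambda>t. (h + integral {t..T} (k z)) / e t) ` {0..T}"
      using cl by (auto simp: G_def)
    ultimately have "bounded (range (G z))" by (rule bounded_subset)
    moreover have "continuous_on UNIV (G z)"
    proof -
      have "continuous_on UNIV cl" unfolding cl_def by (intro continuous_intros)
      then have "continuous_on UNIV ((\<lambda>t. (h + integral {t..T} (k z)) / e t) \<circ> cl)"
        by (rule continuous_on_compose) (rule continuous_on_subset[OF c0], use cl in auto)
      then show ?thesis by (simp add: G_def comp_def cong: continuous_on_cong)
    qed
    ultimately show ?thesis by (simp add: bcontfun_def)
  qed
  have apply_G: "apply_bcontfun (Bcontfun (G z)) = G z" for z
    by (rule Bcontfun_inverse[OF G_mem])
  \<comment> \<open>\<open>L\<close> times the integral of \<open>e\<close> over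
    \<open>{t..T}\<close> is \<open>(e t - 1) / 2\<close>; the division by \<open>e t\<close> in
    \<open>G\<close> leaves the factor one half, whatever the length of the interval.\<close>
  have contr: "dist (Bcontfun (G z)) (Bcontfun (G z')) \<le> 1/2 * dist z z'" for z z'
  proof (rule dist_bound)
    fix t0
    define t where "t = cl t0"
    have t: "t \<in> {0..T}" unfolding t_def by (rule cl)
    have E: "(e has_integral (e t - 1) / (2 * L)) {t..T}"
      unfolding e_def using integral_exp_backward[of "2 * L" t T] L t by simp
    have "\<bar>integral {t..T} (k z) - integral {t..T} (k z')\<bar> = norm (integral {t..T} (\<lambda>s. k z s - k z' s))"
      by (simp add: integral_diff k_int)
    also have "\<dots> \<le> integral {t..T} (\<lambda>s. L * dist z z' * e s)"
    proof (rule integral_norm_bound_integral)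
      show "(\<lambda>s. k z s - k z' s) integrable_on {t..T}" by (intro integrable_diff k_int)
      show "(\<lambda>s. L * dist z z' * e s) integrable_on {t..T}"
        by (intro integrable_continuous_real continuous_intros e_cont)
      fix s
      have "\<bar>k z s - k z' s\<bar> \<le> L * \<bar>e s * apply_bcontfun z s - e s * apply_bcontfun z' s\<bar>"
        unfolding k_def by (rule lip)
      also have "\<dots> = L * (e s * dist (apply_bcontfun z s) (apply_bcontfun z' s))"
        using e[of s] by (simp add: dist_real_def abs_mult flip: right_diff_distrib)
      also have "\<dots> \<le> L * (e s * dist z z')"
        using L e[of s] dist_bounded[of z s z'] by (intro mult_left_mono) auto
      finally show "norm (k z s - k z' s) \<le> L * dist z z' * e s" by (simp add: mult_ac)
    qed
    also have "\<dots> = L * dist z z' * ((e t - 1) / (2 * L))"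
      using integral_unique[OF E] by simp
    also have "\<dots> = 1/2 * dist z z' * (e t - 1)"
      using L by simp
    also have "\<dots> \<le> 1/2 * dist z z' * e t" by (intro mult_left_mono) auto
    finally have "\<bar>integral {t..T} (k z) - integral {t..T} (k z')\<bar> / e t \<le> 1/2 * dist z z'"
      using e[of t] by (simp add: divide_le_eq)
    then have "dist (G z t0) (G z' t0) \<le> 1/2 * dist z z'"
      using e[of t] by (simp add: G_def dist_real_def flip: t_def diff_divide_distrib)
    then show "dist (apply_bcontfun (Bcontfun (G z)) t0) (apply_bcontfun (Bcontfun (G z')) t0)
        \<le> 1/2 * dist z z'"
      by (simp add: apply_G)
  qed
  \<comment> \<open>Multiplying the fixed point by \<open>e\<close> undoes the substitution; on
    \<open>{0..T}\<close> the map \<open>cl\<close> is the identity.\<close>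
  obtain z where "Bcontfun (G z) = z"
    using banach_fix_type[of "1/2" "\<lambda>z. Bcontfun (G z)"] contr by auto
  then have z: "apply_bcontfun z t = G z t" for t by (metis apply_G)
  let ?y = "\<lambda>s. e s * apply_bcontfun z s"
  show ?thesis
  proof (rule that)
    show "set_integrable lborel {0..T} (\<lambda>s. \<Phi> s (?y s))" using k_set[of 0 T z] unfolding k_def[abs_def] .
    fix t assume "t \<in> {0..T}"
    then have "?y t = h + integral {t..T} (k z)" using e by (subst z) (simp add: G_def cl_id)
    also have "\<dots> = h + (LBINT s:{t..T}. k z s)" by (simp add: k_int)
    finally show "?y t = h + (LBINT s:{t..T}. \<Phi> s (?y s))" by (simp only: k_def)
  qed
qed

section \<open>Measurability and bounds of suprema and essential suprema\<close>

text \<open>Continuity in the parameter reduces the uncountable supremum to a countable dense one;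
  \<^const>\<open>esssup\<close> is \<open>\<infinity>\<close> on non-measurable functions, so this is needed for finiteness already.\<close>

lemma borel_measurable_SUP_continuous:
  fixes G :: "'n \<Rightarrow> 'p::second_countable_topology \<Rightarrow> real"
  assumes "open S"
    and meas: "\<And>p. p \<in> S \<Longrightarrow> (\<lambda>\<omega>. G \<omega> p) \<in> borel_measurable N"
    and cont: "\<And>\<omega>. \<omega> \<in> space N \<Longrightarrow> continuous_on S (G \<omega>)"
  shows "(\<lambda>\<omega>. SUP p\<in>S. ereal (G \<omega> p)) \<in> borel_measurable N"
proof -
  obtain D :: "'p set" where D: "countable D" "\<And>X. open X \<Longrightarrow> X \<noteq> {} \<Longrightarrow> \<exists>d\<in>D. d \<in> X"
    using countable_dense_setE by blast
  have eq: "(SUP p\<in>S. ereal (G \<omega> p)) = (SUP p\<in>S \<inter> D. ereal (G \<omega> p))" if \<omega>: "\<omega> \<in> space N" for \<omega>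
  proof (rule antisym)
    show "(SUP p\<in>S. ereal (G \<omega> p)) \<le> (SUP p\<in>S \<inter> D. ereal (G \<omega> p))"
    proof (rule SUP_least, rule ccontr)
      fix p assume p: "p \<in> S" and "\<not> ereal (G \<omega> p) \<le> (SUP p\<in>S \<inter> D. ereal (G \<omega> p))"
      \<comment> \<open>The superlevel set of a real \<open>a\<close> strictly between the two
        values is open and contains \<open>p\<close>, so it meets \<open>D\<close>, which
        contradicts the choice of \<open>a\<close>.\<close>
      then obtain a where a: "(SUP p\<in>S \<inter> D. ereal (G \<omega> p)) < ereal a" "ereal a < ereal (G \<omega> p)"
        using ereal_dense2[of "SUP p\<in>S \<inter> D. ereal (G \<omega> p)" "ereal (G \<omega> p)"] by (auto simp: not_le)
      have "open (S \<inter> G \<omega> -` {a<..})"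
        using continuous_open_preimage[OF cont[OF \<omega>] \<open>open S\<close> open_greaterThan] .
      moreover have "p \<in> S \<inter> G \<omega> -` {a<..}" using p a by simp
      ultimately obtain d where d: "d \<in> D" "d \<in> S" "a < G \<omega> d"
        using D(2)[of "S \<inter> G \<omega> -` {a<..}"] by auto
      then have "ereal (G \<omega> d) \<le> (SUP p\<in>S \<inter> D. ereal (G \<omega> p))" by (intro SUP_upper) auto
      then have "ereal (G \<omega> d) < ereal a" using a(1) by (rule le_less_trans)
      with d show False by simp
    qed
  qed (intro SUP_subset_mono, auto)
  have "(\<lambda>\<omega>. SUP p\<in>S \<inter> D. ereal (G \<omega> p)) \<in> borel_measurable N"
    by (intro borel_measurable_SUP borel_measurable_ereal meas) (use D in auto)
  then show ?thesis by (subst measurable_cong[OF eq])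
qed

text \<open>The lower bound rests on total mass one: a statement free of \<omega> that holds almost
  everywhere is true.\<close>

lemma (in prob_space) esssup_bounds:
  fixes X :: "'a \<Rightarrow> ereal"
  assumes "X \<in> borel_measurable M" and "\<And>\<omega>. \<omega> \<in> space M \<Longrightarrow> a \<le> X \<omega>"
    and "\<And>\<omega>. \<omega> \<in> space M \<Longrightarrow> X \<omega> \<le> b"
  shows "a \<le> esssup M X" and "esssup M X \<le> b"
proof -
  show "esssup M X \<le> b" by (rule esssup_I[OF assms(1)]) (rule AE_I2[OF assms(3)])
  have "AE \<omega> in M. a \<le> esssup M X"
    using esssup_AE[of X M] AE_space
    by eventually_elim (rule order_trans[OF assms(2)])
  then show "a \<le> esssup M X" by (simp only: AE_const)
qed

text \<open>With one of \<open>X\<close>, \<open>Y\<close> the supremum of a family and the other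
  that of the negated family, this places the essential infimum below the essential
  supremum.\<close>

lemma (in prob_space) esssup_uminus_ge:
  fixes X Y :: "'a \<Rightarrow> ereal"
  assumes "\<And>\<omega>. \<omega> \<in> space M \<Longrightarrow> - X \<omega> \<le> Y \<omega>"
  shows "- esssup M X \<le> esssup M Y"
proof -
  have "AE \<omega> in M. - esssup M X \<le> esssup M Y"
    using esssup_AE[of X M] esssup_AE[of Y M] AE_space
  proof eventually_elim
    case (elim \<omega>)
    have "- esssup M X \<le> - X \<omega>" using elim by simp
    also have "\<dots> \<le> Y \<omega>" using elim assms by blast
    also have "\<dots> \<le> esssup M Y" using elim by simp
    finally show ?case .
  qed
  then show ?thesis by (simp only: AE_const)
qed

text \<open>The essential supremum is at most \<open>a\<close> exactly when the section of the set
  where \<open>X\<close> exceeds \<open>a\<close> is null, and the measure of a section depends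
  measurably on \<open>t\<close>.\<close>

lemma (in sigma_finite_measure) borel_measurable_esssup:
  fixes X :: "'n \<Rightarrow> 'a \<Rightarrow> ereal"
  assumes X: "(\<lambda>(t, \<omega>). X t \<omega>) \<in> borel_measurable (N \<Otimes>\<^sub>M M)"
  shows "(\<lambda>t. esssup M (X t)) \<in> borel_measurable N"
proof (rule borel_measurableI_le)
  fix a
  let ?Q = "{p \<in> space (N \<Otimes>\<^sub>M M). a < (\<lambda>(t, \<omega>). X t \<omega>) p}"
  have "?Q = (\<lambda>(t, \<omega>). X t \<omega>) -` {a<..} \<inter> space (N \<Otimes>\<^sub>M M)" by auto
  then have Q: "?Q \<in> sets (N \<Otimes>\<^sub>M M)" using measurable_sets[OF X, of "{a<..}"] by simp
  have "esssup M (X t) \<le> a \<longleftrightarrow> emeasure M (Pair t -` ?Q) = 0" if t: "t \<in> space N" for t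
  proof -
    have Xt: "X t \<in> borel_measurable M"
      using measurable_compose[OF measurable_Pair1'[OF t] X] by simp
    have "{\<omega> \<in> space M. \<not> X t \<omega> \<le> a} = X t -` {a<..} \<inter> space M" by auto
    then have Xa: "{\<omega> \<in> space M. \<not> X t \<omega> \<le> a} \<in> sets M"
      using measurable_sets[OF Xt, of "{a<..}"] by simp
    have "esssup M (X t) \<le> a \<longleftrightarrow> (AE \<omega> in M. X t \<omega> \<le> a)"
    proof
      assume "esssup M (X t) \<le> a"
      have "AE \<omega> in M. X t \<omega> \<le> esssup M (X t)" by (rule esssup_AE)
      then show "AE \<omega> in M. X t \<omega> \<le> a"
        by eventually_elim (rule order_trans[OF _ \<open>esssup M (X t) \<le> a\<close>])
    qed (rule esssup_I[OF Xt])
    also have "\<dots> \<longleftrightarrow> emeasure M {\<omega> \<in> space M. \<not> X t \<omega> \<le> a} = 0"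
      by (rule AE_iff_measurable[OF _ refl]) (rule Xa)
    also have "{\<omega> \<in> space M. \<not> X t \<omega> \<le> a} = Pair t -` ?Q"
      using t by (auto simp: space_pair_measure)
    finally show ?thesis .
  qed
  then have "{t \<in> space N. esssup M (X t) \<le> a} = {t \<in> space N. emeasure M (Pair t -` ?Q) = 0}"
    by auto
  also have "\<dots> = (\<lambda>t. emeasure M (Pair t -` ?Q)) -` {0} \<inter> space N" by auto
  also have "\<dots> \<in> sets N" by (rule measurable_sets[OF measurable_emeasure_Pair[OF Q]]) simp
  finally show "{t \<in> space N. esssup M (X t) \<le> a} \<in> sets N" .
qed

section \<open>Essential suprema of Lipschitz families and the truncated equation\<close>

text \<open>Keeps only what the argument uses of \<open>F\<close>: \<open>p\<close> stands for the
  two points entering the difference quotients and \<open>S\<close> for the admissible pairs. The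
  estimates are confined to \<open>\<bar>y\<bar> \<le> c\<close>, where the denominator will be
  bounded away from zero. Openness of \<open>S\<close> and continuity in \<open>p\<close> serve the
  reduction to countable suprema.\<close>

locale lipschitz_family = prob_space M
  for M :: "'w measure" +
  fixes G :: "real \<Rightarrow> 'w \<Rightarrow> real \<Rightarrow> 'p::second_countable_topology \<Rightarrow> real"
    and S :: "'p set" and T c C L :: real
  assumes T: "0 \<le> T" and c: "0 \<le> c" and L: "0 < L" and S: "open S" "S \<noteq> {}"
    and G_cont: "\<And>t \<omega> y. t \<in> {0..T} \<Longrightarrow> \<omega> \<in> space M \<Longrightarrow> \<bar>y\<bar> \<le> c \<Longrightarrow> continuous_on S (G t \<omega> y)"
    and G_meas: "\<And>p y. p \<in> S \<Longrightarrow> \<bar>y\<bar> \<le> c \<Longrightarrow>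
      (\<lambda>(t, \<omega>). G t \<omega> y p) \<in> borel_measurable (restrict_space borel {0..T} \<Otimes>\<^sub>M M)"
    and G_bound: "\<And>t \<omega> y p. t \<in> {0..T} \<Longrightarrow> \<omega> \<in> space M \<Longrightarrow> \<bar>y\<bar> \<le> c \<Longrightarrow> p \<in> S \<Longrightarrow> \<bar>G t \<omega> y p\<bar> \<le> C"
    and G_lip: "\<And>t \<omega> y y' p. t \<in> {0..T} \<Longrightarrow> \<omega> \<in> space M \<Longrightarrow> \<bar>y\<bar> \<le> c \<Longrightarrow> \<bar>y'\<bar> \<le> c \<Longrightarrow> p \<in> S \<Longrightarrow>
      \<bar>G t \<omega> y p - G t \<omega> y' p\<bar> \<le> L * \<bar>y - y'\<bar>"
begin

definition sup_G :: "real \<Rightarrow> 'w \<Rightarrow> real \<Rightarrow> ereal" where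
  "sup_G t \<omega> y = (SUP p\<in>S. ereal (G t \<omega> y p))"

definition ess_G :: "real \<Rightarrow> real \<Rightarrow> ereal" where
  "ess_G t y = esssup M (\<lambda>\<omega>. sup_G t \<omega> y)"

text \<open>Clamping \<open>y\<close> and extending by zero in time make the bound and the Lipschitz
  estimate hold for all real arguments, as the existence lemma demands.\<close>

definition trunc :: "real \<Rightarrow> real \<Rightarrow> real" where
  "trunc t y = indicator {0..T} t * real_of_ereal (ess_G t (max (- c) (min c y)))"

lemma sup_G_measurable_pair:
  assumes "\<bar>y\<bar> \<le> c"
  shows "(\<lambda>(t, \<omega>). sup_G t \<omega> y) \<in> borel_measurable (restrict_space borel {0..T} \<Otimes>\<^sub>M M)"
proof -
  have "(\<lambda>q. SUP p\<in>S. ereal ((\<lambda>(t, \<omega>). G t \<omega> y) q p))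
      \<in> borel_measurable (restrict_space borel {0..T} \<Otimes>\<^sub>M M)"
  proof (rule borel_measurable_SUP_continuous[OF S(1)])
    fix p assume "p \<in> S"
    then show "(\<lambda>q. (\<lambda>(t, \<omega>). G t \<omega> y) q p) \<in> borel_measurable (restrict_space borel {0..T} \<Otimes>\<^sub>M M)"
      using G_meas[OF _ assms] by (simp add: case_prod_beta')
  next
    fix q assume "q \<in> space (restrict_space borel {0..T} \<Otimes>\<^sub>M M)"
    then show "continuous_on S ((\<lambda>(t, \<omega>). G t \<omega> y) q)"
      by (auto simp: space_pair_measure space_restrict_space intro!: G_cont assms)
  qed
  then show ?thesis by (simp add: sup_G_def case_prod_beta')
qed

lemma sup_G_measurable:
  assumes "t \<in> {0..T}" "\<bar>y\<bar> \<le> c"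
  shows "(\<lambda>\<omega>. sup_G t \<omega> y) \<in> borel_measurable M"
proof -
  have "t \<in> space (restrict_space borel {0..T})" using assms by (simp add: space_restrict_space)
  from measurable_compose[OF measurable_Pair1'[OF this] sup_G_measurable_pair[OF assms(2)]]
  show ?thesis by simp
qed

lemma ess_G_bounds:
  assumes "t \<in> {0..T}" "\<bar>y\<bar> \<le> c"
  shows "- ereal C \<le> ess_G t y" "ess_G t y \<le> ereal C"
proof -
  have 1: "- ereal C \<le> sup_G t \<omega> y" and 2: "sup_G t \<omega> y \<le> ereal C" if "\<omega> \<in> space M" for \<omega>
  proof -
    obtain p where p: "p \<in> S" using S by auto
    have "- ereal C \<le> ereal (G t \<omega> y p)" using G_bound[OF assms(1) that assms(2) p] by simp
    also have "\<dots> \<le> sup_G t \<omega> y" unfolding sup_G_def using p by (rule SUP_upper)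
    finally show "- ereal C \<le> sup_G t \<omega> y" .
    show "sup_G t \<omega> y \<le> ereal C"
      unfolding sup_G_def using G_bound[OF assms(1) that assms(2)] by (intro SUP_least) force
  qed
  show "- ereal C \<le> ess_G t y" "ess_G t y \<le> ereal C"
    unfolding ess_G_def using esssup_bounds[OF sup_G_measurable[OF assms] 1 2] by auto
qed

text \<open>Makes the passage from \<open>ereal\<close> to \<open>real\<close> lossless for
  \<open>\<bar>y\<bar> \<le> c\<close>.\<close>

lemma ess_G_finite:
  assumes "t \<in> {0..T}" "\<bar>y\<bar> \<le> c"
  shows "\<bar>ess_G t y\<bar> \<noteq> \<infinity>" "ereal (real_of_ereal (ess_G t y)) = ess_G t y"
proof -
  show *: "\<bar>ess_G t y\<bar> \<noteq> \<infinity>" using ess_G_bounds[OF assms] by (cases "ess_G t y") auto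
  then show "ereal (real_of_ereal (ess_G t y)) = ess_G t y" by (simp add: ereal_real)
qed

text \<open>A Lipschitz constant common to all members survives the supremum and the essential
  supremum. The one-sided inequality is shown first and then used with \<open>y\<close> and
  \<open>y'\<close> exchanged.\<close>

lemma ess_G_lipschitz:
  assumes t: "t \<in> {0..T}" and y: "\<bar>y\<bar> \<le> c" and y': "\<bar>y'\<bar> \<le> c"
  shows "\<bar>real_of_ereal (ess_G t y) - real_of_ereal (ess_G t y')\<bar> \<le> L * \<bar>y - y'\<bar>"
proof -
  have le: "ess_G t y \<le> ess_G t y' + ereal (L * \<bar>y - y'\<bar>)"
    if y: "\<bar>y\<bar> \<le> c" and y': "\<bar>y'\<bar> \<le> c" for y y'
    unfolding ess_G_def
  proof (rule esssup_I[OF sup_G_measurable[OF t y]])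
    show "AE \<omega> in M. sup_G t \<omega> y \<le> esssup M (\<lambda>\<omega>. sup_G t \<omega> y') + ereal (L * \<bar>y - y'\<bar>)"
      using esssup_AE[of "\<lambda>\<omega>. sup_G t \<omega> y'" M] AE_space
    proof eventually_elim
      case (elim \<omega>)
      show ?case unfolding sup_G_def[of t \<omega> y]
      proof (rule SUP_least)
        fix p assume p: "p \<in> S"
        have "ereal (G t \<omega> y p) \<le> ereal (G t \<omega> y' p) + ereal (L * \<bar>y - y'\<bar>)"
          using G_lip[OF t elim(2) y y' p] by simp
        also have "\<dots> \<le> sup_G t \<omega> y' + ereal (L * \<bar>y - y'\<bar>)"
          unfolding sup_G_def using p by (intro add_right_mono SUP_upper)
        also have "\<dots> \<le> esssup M (\<lambda>\<omega>. sup_G t \<omega> y') + ereal (L * \<bar>y - y'\<bar>)"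
          using elim(1) by (rule add_right_mono)
        finally show "ereal (G t \<omega> y p) \<le> \<dots>" .
      qed
    qed
  qed
  have le': "real_of_ereal (ess_G t y) \<le> real_of_ereal (ess_G t y') + L * \<bar>y - y'\<bar>"
    if y: "\<bar>y\<bar> \<le> c" and y': "\<bar>y'\<bar> \<le> c" for y y'
    using le[OF y y'] ess_G_finite(2)[OF t y] ess_G_finite(2)[OF t y']
    by (metis ereal_less_eq(3) plus_ereal.simps(1))
  from le'[OF y y'] le'[OF y' y] show ?thesis by (simp add: abs_minus_commute)
qed

lemma clamp_bound: "\<bar>max (- c) (min c y)\<bar> \<le> c"
  using c by auto

lemma trunc_eq:
  assumes "t \<in> {0..T}" "\<bar>y\<bar> \<le> c"
  shows "trunc t y = real_of_ereal (ess_G t y)"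
proof -
  have "max (- c) (min c y) = y" using assms(2) by auto
  then show ?thesis using assms(1) by (simp add: trunc_def)
qed

lemma trunc_measurable: "(\<lambda>t. trunc t y) \<in> borel_measurable borel"
proof -
  have "(\<lambda>t. real_of_ereal (ess_G t (max (- c) (min c y)))) \<in> borel_measurable (restrict_space borel {0..T})"
    unfolding ess_G_def
    by (intro borel_measurable_real_of_ereal borel_measurable_esssup sup_G_measurable_pair clamp_bound)
  then show ?thesis
    by (subst (asm) borel_measurable_restrict_space_iff) (auto simp: trunc_def)
qed

lemma trunc_bound: "\<bar>trunc t y\<bar> \<le> \<bar>C\<bar>"
proof (cases "t \<in> {0..T}")
  case True
  then show ?thesis
    using ess_G_bounds[OF True clamp_bound[of y]] ess_G_finite(1)[OF True clamp_bound[of y]]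
    by (cases "ess_G t (max (- c) (min c y))") (auto simp: trunc_def)
qed (simp add: trunc_def)

lemma trunc_lipschitz: "\<bar>trunc t y - trunc t y'\<bar> \<le> L * \<bar>y - y'\<bar>"
proof (cases "t \<in> {0..T}")
  case True
  have "\<bar>trunc t y - trunc t y'\<bar> \<le> L * \<bar>max (- c) (min c y) - max (- c) (min c y')\<bar>"
    using ess_G_lipschitz[OF True clamp_bound clamp_bound] True by (simp add: trunc_def)
  also have "\<dots> \<le> L * \<bar>y - y'\<bar>" using L c by (intro mult_left_mono) auto
  finally show ?thesis .
qed (use L in \<open>simp add: trunc_def\<close>)

text \<open>The barrier is \<open>v t = (c - a) exp (- 2 L (T - t))\<close>: since \<open>L v \<ge> \<epsilon>\<close> throughout, the distance
  \<open>c - y\<close> shrinks at rate at most \<open>\<epsilon> + L (c - y)\<close>, hence stays above \<open>v\<close>.\<close>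

lemma solution_below_exists:
  assumes top: "\<And>t. t \<in> {0..T} \<Longrightarrow> ess_G t c \<le> ereal \<epsilon>"
    and h: "h \<le> a" and a: "a < c" and \<epsilon>: "\<epsilon> \<le> L * (c - a) * exp (- (2 * L * T))"
  obtains y where "set_integrable lborel {0..T} (\<lambda>s. trunc s (y s))"
    and "\<And>t. t \<in> {0..T} \<Longrightarrow> y t = h + (LBINT s:{t..T}. trunc s (y s))"
    and "\<And>t. t \<in> {0..T} \<Longrightarrow> y t \<le> c"
proof -
  obtain y where y_int: "set_integrable lborel {0..T} (\<lambda>s. trunc s (y s))"
    and y: "\<And>t. t \<in> {0..T} \<Longrightarrow> y t = h + (LBINT s:{t..T}. trunc s (y s))"
    by (rule backward_caratheodory_existence[OF T L trunc_measurable trunc_bound trunc_lipschitz]) blast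
  define v where "v t = (c - a) * exp (- (2 * L) * (T - t))" for t
  define k where "k s = 2 * L * v s - trunc s (y s)" for s
  have v_int: "((\<lambda>s. 2 * L * v s) has_integral (c - a) - v t) {t..T}" if "t \<le> T" for t
  proof -
    have "((\<lambda>s. 2 * L * (c - a) * exp (- (2 * L) * (T - s))) has_integral
        2 * L * (c - a) * ((exp (- (2 * L) * (T - t)) - 1) / - (2 * L))) {t..T}"
      by (intro has_integral_mult_right integral_exp_backward) (use L that in auto)
    moreover have "2 * L * (c - a) * ((x - 1) / - (2 * L)) = (c - a) - (c - a) * x" for x
      using L by (simp add: field_simps)
    ultimately show ?thesis by (simp only: v_def mult.assoc)
  qed
  have y_sub: "set_integrable lborel {t..T} (\<lambda>s. trunc s (y s))" if "t \<in> {0..T}" for t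
    by (rule set_integrable_subset[OF y_int]) (use that in auto)
  have k_int: "(k has_integral (c - a) - v t - (y t - h)) {t..T}" if t: "t \<in> {0..T}" for t
    unfolding k_def
  proof (rule has_integral_diff)
    show "((\<lambda>s. 2 * L * v s) has_integral (c - a) - v t) {t..T}" using v_int t by simp
    show "((\<lambda>s. trunc s (y s)) has_integral y t - h) {t..T}"
      using set_borel_integral_eq_integral[OF y_sub[OF t]] y[OF t] by (simp add: has_integral_iff)
  qed
  \<comment> \<open>The comparison is made for \<open>c - y - v\<close>. Its value at
    \<open>T\<close> is \<open>c - h - (c - a) = a - h\<close>, and \<open>k\<close> is formally
    minus its derivative.\<close>
  have nonneg: "0 \<le> c - y t - v t" if t: "t \<in> {0..T}" for t
  proof (rule backward_integral_comparison[where w = "\<lambda>t. c - y t - v t", OF L T _ _ _ _ t])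
    show "k integrable_on {0..T}" using k_int[of 0] T by (auto simp: integrable_on_def)
    show "c - y t - v t = (a - h) + integral {t..T} k" if "t \<in> {0..T}" for t
      using integral_unique[OF k_int[OF that]] by simp
    show "0 \<le> a - h" using h by simp
    fix s assume s: "s \<in> {0..T}"
    \<comment> \<open>The barrier increases in time, so its least value is at time 0; the hypothesis
      on \<epsilon> is the required bound there.\<close>
    have "\<epsilon> \<le> L * ((c - a) * exp (- (2 * L * T)))" using \<epsilon> by (simp add: mult.assoc)
    also have "\<dots> \<le> L * v s"
      unfolding v_def using L a s by (intro mult_left_mono) (auto simp: algebra_simps)
    finally have \<epsilon>v: "\<epsilon> \<le> L * v s" .
    have v0: "0 \<le> v s" using a by (simp add: v_def)
    have "trunc s c \<le> \<epsilon>"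
      using top[OF s] ess_G_finite(2)[OF s, of c] trunc_eq[OF s, of c] c by (metis abs_of_nonneg ereal_less_eq(3) order_refl)
    then have "trunc s (y s) \<le> \<epsilon> + L * \<bar>y s - c\<bar>" using trunc_lipschitz[of s "y s" c] by simp
    \<comment> \<open>Of the growth \<open>2 * L * v s\<close> in \<open>k\<close>, one half absorbs
      \<epsilon> and the other the \<open>v s\<close> split off from \<open>c - y s\<close>.\<close>
    also have "\<dots> \<le> L * v s + L * (\<bar>c - y s - v s\<bar> + v s)"
      using \<epsilon>v v0 L by (intro add_mono mult_left_mono) auto
    finally show "- (L * \<bar>c - y s - v s\<bar>) \<le> k s" by (simp add: k_def algebra_simps)
  qed
  have "y t \<le> c" if "t \<in> {0..T}" for t
  proof -
    have "0 \<le> v t" using a by (simp add: v_def)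
    with nonneg[OF that] show ?thesis by simp
  qed
  with y_int y that show ?thesis by blast
qed

end

section \<open>Reflection and the pair of solutions\<close>

text \<open>Changing the sign of both \<open>y\<close> and the value turns the lower equation into
  an upper one; since \<open>[-c, c]\<close> is symmetric, every estimate survives with the same
  constants.\<close>

lemma lipschitz_family_reflect:
  assumes "lipschitz_family M G S T c C L"
  shows "lipschitz_family M (\<lambda>t \<omega> y p. - G t \<omega> (- y) p) S T c C L"
proof -
  interpret lipschitz_family M G S T c C L by fact
  show ?thesis
  proof unfold_locales
    fix t \<omega> y y' p
    assume "t \<in> {0..T}" "\<omega> \<in> space M" "\<bar>y\<bar> \<le> c" "\<bar>y'\<bar> \<le> c" "p \<in> S"
    then show "\<bar>- G t \<omega> (- y) p - - G t \<omega> (- y') p\<bar> \<le> L * \<bar>y - y'\<bar>"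
      using G_lip[of t \<omega> "- y" "- y'" p] by (simp add: abs_minus_commute)
  next
    fix p y assume "p \<in> S" "\<bar>y\<bar> \<le> c"
    then show "(\<lambda>(t, \<omega>). - G t \<omega> (- y) p) \<in> borel_measurable (restrict_space borel {0..T} \<Otimes>\<^sub>M M)"
      using borel_measurable_uminus[OF G_meas[of p "- y"]] by (simp add: case_prod_beta')
  qed (use T c L S G_bound in \<open>auto intro!: continuous_intros G_cont\<close>)
qed

context lipschitz_family
begin

text \<open>The essential infimum in the form that makes it minus the \<open>ess_G\<close> of the
  reflected family at \<open>- y\<close>.\<close>

definition ess_low :: "real \<Rightarrow> real \<Rightarrow> ereal" where
  "ess_low t y = - esssup M (\<lambda>\<omega>. SUP p\<in>S. ereal (- G t \<omega> y p))"

text \<open>Solve the truncated equations of the family and of its reflection, getting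
  \<open>y \<le> c\<close> and \<open>z \<le> c\<close>, and take \<open>- z\<close> as lower
  solution. Comparison gives \<open>- z \<le> y\<close>, which supplies both missing bounds, so the
  truncated equations are the original ones.\<close>

lemma two_sided_solutions_exist:
  assumes top: "\<And>t. t \<in> {0..T} \<Longrightarrow> ess_G t c \<le> ereal \<epsilon>"
    and bot: "\<And>t. t \<in> {0..T} \<Longrightarrow> ereal (- \<epsilon>) \<le> ess_low t (- c)"
    and h: "h\<^sub>1 \<le> h\<^sub>2" "- a \<le> h\<^sub>1" "h\<^sub>2 \<le> a" and a: "a < c"
    and \<epsilon>: "\<epsilon> \<le> L * (c - a) * exp (- (2 * L * T))"
  obtains y\<^sub>1 y\<^sub>2 where "ode_solution T (ereal h\<^sub>2) ess_G y\<^sub>2" and "ode_solution T (ereal h\<^sub>1) ess_low y\<^sub>1"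
    and "\<And>t. t \<in> {0..T} \<Longrightarrow> - c \<le> y\<^sub>1 t \<and> y\<^sub>1 t \<le> y\<^sub>2 t \<and> y\<^sub>2 t \<le> c"
proof -
  interpret R: lipschitz_family M "\<lambda>t \<omega> y p. - G t \<omega> (- y) p" S T c C L
    by (rule lipschitz_family_reflect) unfold_locales
  have ess_low_eq: "ess_low t y = - R.ess_G t (- y)" for t y
    by (simp add: ess_low_def R.ess_G_def R.sup_G_def)
  \<comment> \<open>This is the inequality between essential infimum and essential supremum, read at
    \<open>- y\<close>.\<close>
  have low_le: "- ess_G t (- y) \<le> R.ess_G t y" for t y
    unfolding ess_G_def R.ess_G_def
  proof (rule esssup_uminus_ge)
    fix \<omega>
    obtain p where p: "p \<in> S" using S by auto
    have "- sup_G t \<omega> (- y) \<le> - ereal (G t \<omega> (- y) p)"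
      unfolding sup_G_def ereal_minus_le_minus using p by (rule SUP_upper)
    also have "\<dots> \<le> R.sup_G t \<omega> y"
      unfolding R.sup_G_def uminus_ereal.simps using p by (rule SUP_upper)
    finally show "- sup_G t \<omega> (- y) \<le> R.sup_G t \<omega> y" .
  qed
  have trunc_low_le: "- trunc s (- z) \<le> R.trunc s z" if s: "s \<in> {0..T}" for s z
  proof -
    let ?z = "max (- c) (min c z)"
    \<comment> \<open>The clamp is an odd function, so truncation commutes with reflection.\<close>
    have "max (- c) (min c (- z)) = - ?z" using c by (auto simp: max_def min_def)
    moreover have "- real_of_ereal (ess_G s (- ?z)) \<le> real_of_ereal (R.ess_G s ?z)"
    proof -
      have "\<bar>- ?z\<bar> \<le> c" using clamp_bound by simp
      then have "ereal (- real_of_ereal (ess_G s (- ?z))) = - ess_G s (- ?z)"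
        using ess_G_finite(2)[OF s] by (simp flip: uminus_ereal.simps)
      also have "\<dots> \<le> R.ess_G s ?z" by (rule low_le)
      also have "\<dots> = ereal (real_of_ereal (R.ess_G s ?z))"
        using R.ess_G_finite(2)[OF s clamp_bound] by simp
      finally show ?thesis by simp
    qed
    ultimately show ?thesis using s by (simp add: trunc_def R.trunc_def)
  qed
  obtain y where y_int: "set_integrable lborel {0..T} (\<lambda>s. trunc s (y s))"
    and y: "\<And>t. t \<in> {0..T} \<Longrightarrow> y t = h\<^sub>2 + (LBINT s:{t..T}. trunc s (y s))"
    and y_le: "\<And>t. t \<in> {0..T} \<Longrightarrow> y t \<le> c"
    using solution_below_exists[OF top h(3) a \<epsilon>] by blast
  have R_top: "R.ess_G t c \<le> ereal \<epsilon>" if "t \<in> {0..T}" for t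
    using bot[OF that] unfolding ess_low_eq minus_minus uminus_ereal.simps[symmetric] ereal_minus_le_minus .
  have "- h\<^sub>1 \<le> a" using h by simp
  then obtain z where z_int: "set_integrable lborel {0..T} (\<lambda>s. R.trunc s (z s))"
    and z: "\<And>t. t \<in> {0..T} \<Longrightarrow> z t = - h\<^sub>1 + (LBINT s:{t..T}. R.trunc s (z s))"
    and z_le: "\<And>t. t \<in> {0..T} \<Longrightarrow> z t \<le> c"
    using R.solution_below_exists[OF R_top _ a \<epsilon>] by blast
  have has: "((\<lambda>s. trunc s (y s)) has_integral y t - h\<^sub>2) {t..T}"
    "((\<lambda>s. R.trunc s (z s)) has_integral z t + h\<^sub>1) {t..T}" if t: "t \<in> {0..T}" for t
  proof -
    have sub: "{t..T} \<subseteq> {0..T}" using t by auto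
    show "((\<lambda>s. trunc s (y s)) has_integral y t - h\<^sub>2) {t..T}"
      using set_borel_integral_eq_integral[OF set_integrable_subset[OF y_int _ sub]] y[OF t]
      by (simp add: has_integral_iff)
    show "((\<lambda>s. R.trunc s (z s)) has_integral z t + h\<^sub>1) {t..T}"
      using set_borel_integral_eq_integral[OF set_integrable_subset[OF z_int _ sub]] z[OF t]
      by (simp add: has_integral_iff)
  qed
  let ?k = "\<lambda>s. trunc s (y s) + R.trunc s (z s)"
  have k: "(?k has_integral (y t - h\<^sub>2) + (z t + h\<^sub>1)) {t..T}" if "t \<in> {0..T}" for t
    by (intro has_integral_add has that)
  \<comment> \<open>At \<open>- z s\<close> the two truncated drifts have nonnegative sum by
    \<open>trunc_low_le\<close>; moving the first one to \<open>y s\<close> costs at most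
    \<open>L * \<bar>y s + z s\<bar>\<close>.\<close>
  have le: "0 \<le> y t + z t" if t: "t \<in> {0..T}" for t
  proof (rule backward_integral_comparison[where w = "\<lambda>t. y t + z t" and k = ?k, OF L T _ _ _ _ t])
    show "?k integrable_on {0..T}" using k[of 0] T by (auto simp: integrable_on_def)
    show "y t + z t = (h\<^sub>2 - h\<^sub>1) + integral {t..T} ?k" if "t \<in> {0..T}" for t
      using integral_unique[OF k[OF that]] by simp
    show "0 \<le> h\<^sub>2 - h\<^sub>1" using h by simp
    fix s assume s: "s \<in> {0..T}"
    show "- (L * \<bar>y s + z s\<bar>) \<le> ?k s"
      using trunc_low_le[OF s, of "z s"] trunc_lipschitz[of s "y s" "- z s"] by simp
  qed
  \<comment> \<open>Each solution gets its second bound from the other: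
    \<open>y \<ge> - z \<ge> - c\<close> and \<open>- z \<le> y \<le> c\<close>.\<close>
  have order: "- c \<le> - z t \<and> - z t \<le> y t \<and> y t \<le> c" if "t \<in> {0..T}" for t
    using le[OF that] y_le[OF that] z_le[OF that] by simp
  have bd: "\<bar>y t\<bar> \<le> c" "\<bar>z t\<bar> \<le> c" if "t \<in> {0..T}" for t using order[OF that] by auto
  show ?thesis
  proof (rule that)
    have eq: "real_of_ereal (ess_G s (y s)) = trunc s (y s)" if "s \<in> {0..T}" for s
      using trunc_eq[OF that bd(1)[OF that]] by simp
    show "ode_solution T (ereal h\<^sub>2) ess_G y"
      unfolding ode_solution_def
    proof (intro conjI ballI)
      show "set_integrable lborel {0..T} (\<lambda>s. real_of_ereal (ess_G s (y s)))"
        using y_int by (subst set_integrable_cong[OF refl refl eq])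
      fix t assume t: "t \<in> {0..T}"
      show "\<bar>ess_G t (y t)\<bar> \<noteq> \<infinity>" by (rule ess_G_finite[OF t bd(1)[OF t]])
      have "(LBINT s:{t..T}. real_of_ereal (ess_G s (y s))) = (LBINT s:{t..T}. trunc s (y s))"
        by (rule set_lebesgue_integral_cong) (use t eq in auto)
      then show "y t = real_of_ereal (ereal h\<^sub>2) + (LBINT s:{t..T}. real_of_ereal (ess_G s (y s)))"
        using y[OF t] by simp
    qed simp
    have eq: "real_of_ereal (ess_low s (- z s)) = - R.trunc s (z s)" if "s \<in> {0..T}" for s
      using R.trunc_eq[OF that bd(2)[OF that]] by (simp add: ess_low_eq)
    show "ode_solution T (ereal h\<^sub>1) ess_low (\<lambda>t. - z t)"
      unfolding ode_solution_def
    proof (intro conjI ballI)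
      have "set_integrable lborel {0..T} (\<lambda>s. - R.trunc s (z s))"
        using z_int by (simp add: set_integrable_def)
      then show "set_integrable lborel {0..T} (\<lambda>s. real_of_ereal (ess_low s (- z s)))"
        by (subst set_integrable_cong[OF refl refl eq])
      fix t assume t: "t \<in> {0..T}"
      show "\<bar>ess_low t (- z t)\<bar> \<noteq> \<infinity>"
        using R.ess_G_finite(1)[OF t bd(2)[OF t]] by (simp add: ess_low_eq)
      have "(LBINT s:{t..T}. real_of_ereal (ess_low s (- z s))) = (LBINT s:{t..T}. - R.trunc s (z s))"
        by (rule set_lebesgue_integral_cong) (use t eq in auto)
      also have "\<dots> = - (LBINT s:{t..T}. R.trunc s (z s))"
        by (simp add: set_lebesgue_integral_def)
      finally show "- z t = real_of_ereal (ereal h\<^sub>1) + (LBINT s:{t..T}. real_of_ereal (ess_low s (- z s)))"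
        using z[OF t] by simp
    qed simp
  qed (rule order)
qed

end

section \<open>Bounds for \<open>F\<close> as a function of \<open>y\<close>\<close>

text \<open>This is \<open>F\<close> with its nine difference quotients frozen as real
  parameters.\<close>

definition riccati :: "real \<Rightarrow> real \<Rightarrow> real \<Rightarrow> real \<Rightarrow> real \<Rightarrow> real \<Rightarrow> real \<Rightarrow> real \<Rightarrow> real \<Rightarrow> real \<Rightarrow> real" where
  "riccati b\<^sub>1 b\<^sub>2 b\<^sub>3 s\<^sub>1 s\<^sub>2 s\<^sub>3 f\<^sub>1 f\<^sub>2 f\<^sub>3 y =
     f\<^sub>1 + f\<^sub>2 * y + y * (b\<^sub>1 + b\<^sub>2 * y) + (f\<^sub>3 + b\<^sub>3 * y) * y * (s\<^sub>1 + s\<^sub>2 * y) / (1 - s\<^sub>3 * y)"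

text \<open>Each factor of \<open>riccati\<close> is replaced by its bound in the same bracketing,
  so that the estimate follows the syntax.\<close>

definition riccati_bound :: "real \<Rightarrow> real \<Rightarrow> real \<Rightarrow> real" where
  "riccati_bound K c\<^sub>1 c =
     K + K * c + c * (K + K * c) + (K + K * c) * c * (K + K * c) / (1 - c\<^sub>1 * c)"

text \<open>The same termwise bound for the divided difference of \<open>riccati\<close>, the term
  \<open>?q\<close> in the proof of \<open>riccati_lipschitz\<close>.\<close>

definition riccati_lip :: "real \<Rightarrow> real \<Rightarrow> real \<Rightarrow> real" where
  "riccati_lip K c\<^sub>1 c =
     K + (K + K * (2 * c)) + (K * K + (K * K + K * K) * (2 * c) + K * K * (3 * c * c)) / (1 - c\<^sub>1 * c)
     + (K + K * c) * c * (K + K * c) / (1 - c\<^sub>1 * c) * (c\<^sub>1 / (1 - c\<^sub>1 * c))"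

lemma abs_mult_le:
  fixes x y a b :: real
  assumes "\<bar>x\<bar> \<le> a" "\<bar>y\<bar> \<le> b"
  shows "\<bar>x * y\<bar> \<le> a * b"
  unfolding abs_mult using assms by (intro mult_mono) auto

lemma abs_add_le:
  fixes x y a b :: real
  assumes "\<bar>x\<bar> \<le> a" "\<bar>y\<bar> \<le> b"
  shows "\<bar>x + y\<bar> \<le> a + b"
  using assms by linarith

lemma abs_divide_le:
  fixes x y a d :: real
  assumes "\<bar>x\<bar> \<le> a" "d \<le> y" "0 < d"
  shows "\<bar>x / y\<bar> \<le> a / d"
  using assms by (simp add: abs_divide frac_le)

context
  fixes K c\<^sub>1 c b\<^sub>1 b\<^sub>2 b\<^sub>3 s\<^sub>1 s\<^sub>2 s\<^sub>3 f\<^sub>1 f\<^sub>2 f\<^sub>3 :: real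
  assumes K: "\<bar>b\<^sub>1\<bar> \<le> K" "\<bar>b\<^sub>2\<bar> \<le> K" "\<bar>b\<^sub>3\<bar> \<le> K" "\<bar>s\<^sub>1\<bar> \<le> K" "\<bar>s\<^sub>2\<bar> \<le> K" "\<bar>f\<^sub>1\<bar> \<le> K" "\<bar>f\<^sub>2\<bar> \<le> K" "\<bar>f\<^sub>3\<bar> \<le> K"
    and s\<^sub>3: "\<bar>s\<^sub>3\<bar> \<le> c\<^sub>1" and d: "c\<^sub>1 * c < 1"
begin

lemma denominator_ge:
  assumes "\<bar>y\<bar> \<le> c"
  shows "1 - c\<^sub>1 * c \<le> 1 - s\<^sub>3 * y" "0 < 1 - s\<^sub>3 * y"
  using abs_mult_le[OF s\<^sub>3 assms] d by linarith+

lemma riccati_bounded: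
  assumes y: "\<bar>y\<bar> \<le> c"
  shows "\<bar>riccati b\<^sub>1 b\<^sub>2 b\<^sub>3 s\<^sub>1 s\<^sub>2 s\<^sub>3 f\<^sub>1 f\<^sub>2 f\<^sub>3 y\<bar> \<le> riccati_bound K c\<^sub>1 c"
  unfolding riccati_def riccati_bound_def
  using d by (intro abs_add_le abs_mult_le abs_divide_le K y denominator_ge) auto

text \<open>The increment factors exactly through \<open>y - z\<close>, so bounding the cofactor
  \<open>?q\<close> replaces a derivative estimate.\<close>

lemma riccati_lipschitz:
  assumes y: "\<bar>y\<bar> \<le> c" and z: "\<bar>z\<bar> \<le> c"
  shows "\<bar>riccati b\<^sub>1 b\<^sub>2 b\<^sub>3 s\<^sub>1 s\<^sub>2 s\<^sub>3 f\<^sub>1 f\<^sub>2 f\<^sub>3 y - riccati b\<^sub>1 b\<^sub>2 b\<^sub>3 s\<^sub>1 s\<^sub>2 s\<^sub>3 f\<^sub>1 f\<^sub>2 f\<^sub>3 z\<bar>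
    \<le> riccati_lip K c\<^sub>1 c * \<bar>y - z\<bar>"
proof -
  let ?q = "f\<^sub>2 + (b\<^sub>1 + b\<^sub>2 * (y + z))
      + (f\<^sub>3 * s\<^sub>1 + (f\<^sub>3 * s\<^sub>2 + b\<^sub>3 * s\<^sub>1) * (y + z) + b\<^sub>3 * s\<^sub>2 * (y * y + y * z + z * z)) / (1 - s\<^sub>3 * y)
      + (f\<^sub>3 + b\<^sub>3 * z) * z * (s\<^sub>1 + s\<^sub>2 * z) / (1 - s\<^sub>3 * z) * (s\<^sub>3 / (1 - s\<^sub>3 * y))"
  have nz: "1 - s\<^sub>3 * y \<noteq> 0" "1 - s\<^sub>3 * z \<noteq> 0" using denominator_ge y z by fastforce+
  \<comment> \<open>A quotient rule for increments: the change of numerator is taken over the new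
    denominator, the change of denominator against the old quotient.\<close>
  have quot: "N\<^sub>1 / D\<^sub>1 - N\<^sub>2 / D\<^sub>2 = (y - z) * (P / D\<^sub>1 + N\<^sub>2 / D\<^sub>2 * (s\<^sub>3 / D\<^sub>1))"
    if "N\<^sub>1 - N\<^sub>2 = (y - z) * P" "D\<^sub>2 - D\<^sub>1 = (y - z) * s\<^sub>3" "D\<^sub>1 \<noteq> 0" "D\<^sub>2 \<noteq> 0" for N\<^sub>1 N\<^sub>2 D\<^sub>1 D\<^sub>2 P
  proof -
    have "N\<^sub>1 / D\<^sub>1 - N\<^sub>2 / D\<^sub>2 = (N\<^sub>1 - N\<^sub>2) / D\<^sub>1 + N\<^sub>2 / D\<^sub>2 * ((D\<^sub>2 - D\<^sub>1) / D\<^sub>1)"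
      using that(3,4) by (simp add: field_simps)
    then show ?thesis
      unfolding that(1,2) distrib_left[of "y - z"] by (simp only: times_divide_eq_right mult.left_commute)
  qed
  \<comment> \<open>The numerator is a cubic in \<open>y\<close>; its increment is factored through
    the differences of squares and of cubes.\<close>
  have "(f\<^sub>3 + b\<^sub>3 * y) * y * (s\<^sub>1 + s\<^sub>2 * y) / (1 - s\<^sub>3 * y) - (f\<^sub>3 + b\<^sub>3 * z) * z * (s\<^sub>1 + s\<^sub>2 * z) / (1 - s\<^sub>3 * z)
     = (y - z) * ((f\<^sub>3 * s\<^sub>1 + (f\<^sub>3 * s\<^sub>2 + b\<^sub>3 * s\<^sub>1) * (y + z) + b\<^sub>3 * s\<^sub>2 * (y * y + y * z + z * z)) / (1 - s\<^sub>3 * y)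
        + (f\<^sub>3 + b\<^sub>3 * z) * z * (s\<^sub>1 + s\<^sub>2 * z) / (1 - s\<^sub>3 * z) * (s\<^sub>3 / (1 - s\<^sub>3 * y)))"
    by (rule quot) (use nz in \<open>auto simp: algebra_simps\<close>)
  moreover have "f\<^sub>2 * y + y * (b\<^sub>1 + b\<^sub>2 * y) - (f\<^sub>2 * z + z * (b\<^sub>1 + b\<^sub>2 * z)) = (y - z) * (f\<^sub>2 + (b\<^sub>1 + b\<^sub>2 * (y + z)))"
    by (simp add: algebra_simps)
  ultimately have eq: "riccati b\<^sub>1 b\<^sub>2 b\<^sub>3 s\<^sub>1 s\<^sub>2 s\<^sub>3 f\<^sub>1 f\<^sub>2 f\<^sub>3 y - riccati b\<^sub>1 b\<^sub>2 b\<^sub>3 s\<^sub>1 s\<^sub>2 s\<^sub>3 f\<^sub>1 f\<^sub>2 f\<^sub>3 z = (y - z) * ?q"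
    unfolding riccati_def distrib_left[of "y - z"] by linarith
  have yz: "\<bar>y + z\<bar> \<le> 2 * c" using y z by linarith
  have "\<bar>y * y + y * z + z * z\<bar> \<le> c * c + c * c + c * c"
    by (intro abs_add_le abs_mult_le y z)
  then have yy: "\<bar>y * y + y * z + z * z\<bar> \<le> 3 * c * c" by simp
  have "\<bar>?q\<bar> \<le> riccati_lip K c\<^sub>1 c"
    unfolding riccati_lip_def
    using d by (intro abs_add_le abs_mult_le abs_divide_le K s\<^sub>3 y z yz yy denominator_ge) auto
  then show ?thesis unfolding eq abs_mult by (simp add: mult.commute mult_left_mono)
qed

end

lemma riccati_lip_pos:
  assumes "0 < K" "0 < c\<^sub>1" "0 < c" "c\<^sub>1 * c < 1"
  shows "0 < riccati_lip K c\<^sub>1 c"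
  unfolding riccati_lip_def using assms by (auto intro!: add_pos_nonneg)

section \<open>Difference quotients off the diagonal\<close>

lemma diff_quot_lipschitz_bound:
  assumes "\<And>u v. \<bar>\<psi> u - \<psi> v\<bar> \<le> K * \<bar>u - v\<bar>" "u \<noteq> v"
  shows "\<bar>diff_quot \<psi> u v\<bar> \<le> K"
  using assms(1)[of u v] assms(2) by (simp add: diff_quot_def divide_le_eq)

text \<open>Each quotient moves a single coordinate, along which the Euclidean distance is the
  absolute difference.\<close>

lemma dq_lipschitz_bound:
  assumes \<phi>: "K-lipschitz_on UNIV \<phi>" and p: "(\<theta>\<^sub>1, \<theta>\<^sub>2) \<in> distinct_triples"
  shows "\<bar>dq1 \<phi> \<theta>\<^sub>1 \<theta>\<^sub>2\<bar> \<le> K" "\<bar>dq2 \<phi> \<theta>\<^sub>1 \<theta>\<^sub>2\<bar> \<le> K" "\<bar>dq3 \<phi> \<theta>\<^sub>1 \<theta>\<^sub>2\<bar> \<le> K"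
proof -
  obtain x\<^sub>1 y\<^sub>1 z\<^sub>1 x\<^sub>2 y\<^sub>2 z\<^sub>2 where \<theta>: "\<theta>\<^sub>1 = (x\<^sub>1, y\<^sub>1, z\<^sub>1)" "\<theta>\<^sub>2 = (x\<^sub>2, y\<^sub>2, z\<^sub>2)"
    by (metis prod_cases3)
  then have ne: "x\<^sub>1 \<noteq> x\<^sub>2" "y\<^sub>1 \<noteq> y\<^sub>2" "z\<^sub>1 \<noteq> z\<^sub>2" using p by (auto simp: distinct_triples_def)
  have *: "\<bar>\<phi> \<alpha> - \<phi> \<beta>\<bar> \<le> K * dist \<alpha> \<beta>" for \<alpha> \<beta>
    using lipschitz_onD[OF \<phi>, of \<alpha> \<beta>] by (simp add: dist_real_def)
  have "\<bar>\<phi> (u, y, z) - \<phi> (v, y, z)\<bar> \<le> K * \<bar>u - v\<bar>" for u v y z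
    using *[of "(u, y, z)" "(v, y, z)"] by (simp add: dist_Pair_Pair dist_real_def)
  then show "\<bar>dq1 \<phi> \<theta>\<^sub>1 \<theta>\<^sub>2\<bar> \<le> K" unfolding \<theta> dq1.simps using ne by (intro diff_quot_lipschitz_bound)
  have "\<bar>\<phi> (x, u, z) - \<phi> (x, v, z)\<bar> \<le> K * \<bar>u - v\<bar>" for u v x z
    using *[of "(x, u, z)" "(x, v, z)"] by (simp add: dist_Pair_Pair dist_real_def)
  then show "\<bar>dq2 \<phi> \<theta>\<^sub>1 \<theta>\<^sub>2\<bar> \<le> K" unfolding \<theta> dq2.simps using ne by (intro diff_quot_lipschitz_bound)
  have "\<bar>\<phi> (x, y, u) - \<phi> (x, y, v)\<bar> \<le> K * \<bar>u - v\<bar>" for u v x y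
    using *[of "(x, y, u)" "(x, y, v)"] by (simp add: dist_Pair_Pair dist_real_def)
  then show "\<bar>dq3 \<phi> \<theta>\<^sub>1 \<theta>\<^sub>2\<bar> \<le> K" unfolding \<theta> dq3.simps using ne by (intro diff_quot_lipschitz_bound)
qed

lemma open_distinct_pairs: "open distinct_pairs"
proof -
  have eq: "distinct_pairs = {p. fst p \<noteq> snd p}" by (auto simp: distinct_pairs_def)
  show ?thesis unfolding eq by (intro open_Collect_neq continuous_intros)
qed

lemma open_distinct_triples: "open distinct_triples"
proof -
  have eq: "distinct_triples = {p. fst (fst p) \<noteq> fst (snd p)} \<inter>
      ({p. fst (snd (fst p)) \<noteq> fst (snd (snd p))} \<inter> {p. snd (snd (fst p)) \<noteq> snd (snd (snd p))})"
    by (auto simp: distinct_triples_def)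
  show ?thesis
    unfolding eq by (intro open_Int open_Collect_neq continuous_intros)
qed

text \<open>On distinct triples the lower-limit branch of \<open>diff_quot\<close> is never taken,
  and what remains is a fraction with nonvanishing denominator.\<close>

lemma continuous_on_dq:
  assumes \<phi>: "continuous_on UNIV \<phi>"
  shows "continuous_on distinct_triples (\<lambda>p. dq1 \<phi> (fst p) (snd p))"
    "continuous_on distinct_triples (\<lambda>p. dq2 \<phi> (fst p) (snd p))"
    "continuous_on distinct_triples (\<lambda>p. dq3 \<phi> (fst p) (snd p))"
proof -
  have c: "continuous_on distinct_triples (\<lambda>p. \<phi> (g p))"
    if "continuous_on distinct_triples g" for g
    by (rule continuous_on_compose2[OF \<phi> that]) auto
  let ?x1 = "\<lambda>p::(real \<times> real \<times> real) \<times> (real \<times> real \<times> real). fst (fst p)"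
  let ?y1 = "\<lambda>p::(real \<times> real \<times> real) \<times> (real \<times> real \<times> real). fst (snd (fst p))"
  let ?z1 = "\<lambda>p::(real \<times> real \<times> real) \<times> (real \<times> real \<times> real). snd (snd (fst p))"
  let ?x2 = "\<lambda>p::(real \<times> real \<times> real) \<times> (real \<times> real \<times> real). fst (snd p)"
  let ?y2 = "\<lambda>p::(real \<times> real \<times> real) \<times> (real \<times> real \<times> real). fst (snd (snd p))"
  let ?z2 = "\<lambda>p::(real \<times> real \<times> real) \<times> (real \<times> real \<times> real). snd (snd (snd p))"
  have "continuous_on distinct_triples
      (\<lambda>p. (\<phi> (?x1 p, ?y1 p, ?z1 p) - \<phi> (?x2 p, ?y1 p, ?z1 p)) / (?x1 p - ?x2 p))"
    by (intro continuous_intros c) (auto simp: distinct_triples_def)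
  then show "continuous_on distinct_triples (\<lambda>p. dq1 \<phi> (fst p) (snd p))"
    by (rule continuous_on_eq) (auto simp: distinct_triples_def diff_quot_def)
  have "continuous_on distinct_triples
      (\<lambda>p. (\<phi> (?x2 p, ?y1 p, ?z1 p) - \<phi> (?x2 p, ?y2 p, ?z1 p)) / (?y1 p - ?y2 p))"
    by (intro continuous_intros c) (auto simp: distinct_triples_def)
  then show "continuous_on distinct_triples (\<lambda>p. dq2 \<phi> (fst p) (snd p))"
    by (rule continuous_on_eq) (auto simp: distinct_triples_def diff_quot_def)
  have "continuous_on distinct_triples
      (\<lambda>p. (\<phi> (?x2 p, ?y2 p, ?z1 p) - \<phi> (?x2 p, ?y2 p, ?z2 p)) / (?z1 p - ?z2 p))"
    by (intro continuous_intros c) (auto simp: distinct_triples_def)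
  then show "continuous_on distinct_triples (\<lambda>p. dq3 \<phi> (fst p) (snd p))"
    by (rule continuous_on_eq) (auto simp: distinct_triples_def diff_quot_def)
qed

lemma borel_measurable_dq:
  fixes \<phi> :: "'n \<Rightarrow> real \<times> real \<times> real \<Rightarrow> real"
  assumes \<phi>: "\<And>\<theta>. (\<lambda>q. \<phi> q \<theta>) \<in> borel_measurable N" and p: "p \<in> distinct_triples"
  shows "(\<lambda>q. dq1 (\<phi> q) (fst p) (snd p)) \<in> borel_measurable N"
    "(\<lambda>q. dq2 (\<phi> q) (fst p) (snd p)) \<in> borel_measurable N"
    "(\<lambda>q. dq3 (\<phi> q) (fst p) (snd p)) \<in> borel_measurable N"
proof -
  obtain x\<^sub>1 y\<^sub>1 z\<^sub>1 x\<^sub>2 y\<^sub>2 z\<^sub>2 where p_eq: "p = ((x\<^sub>1, y\<^sub>1, z\<^sub>1), (x\<^sub>2, y\<^sub>2, z\<^sub>2))"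
    by (metis prod.exhaust)
  then have ne: "x\<^sub>1 \<noteq> x\<^sub>2" "y\<^sub>1 \<noteq> y\<^sub>2" "z\<^sub>1 \<noteq> z\<^sub>2" using p by (auto simp: distinct_triples_def)
  show "(\<lambda>q. dq1 (\<phi> q) (fst p) (snd p)) \<in> borel_measurable N"
    "(\<lambda>q. dq2 (\<phi> q) (fst p) (snd p)) \<in> borel_measurable N"
    "(\<lambda>q. dq3 (\<phi> q) (fst p) (snd p)) \<in> borel_measurable N"
    unfolding p_eq fst_conv snd_conv dq1.simps dq2.simps dq3.simps diff_quot_def if_P[OF ne(1)] if_P[OF ne(2)] if_P[OF ne(3)]
    by (intro borel_measurable_divide borel_measurable_diff borel_measurable_const \<phi>)+
qed

section \<open>The function \<open>F\<close> as a Lipschitz family\<close>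

lemma F_fun_eq_riccati:
  "F_fun b \<sigma> f \<theta>\<^sub>1 \<theta>\<^sub>2 t \<omega> y =
     riccati (dq1 (b t \<omega>) \<theta>\<^sub>1 \<theta>\<^sub>2) (dq2 (b t \<omega>) \<theta>\<^sub>1 \<theta>\<^sub>2) (dq3 (b t \<omega>) \<theta>\<^sub>1 \<theta>\<^sub>2)
       (dq1 (\<sigma> t \<omega>) \<theta>\<^sub>1 \<theta>\<^sub>2) (dq2 (\<sigma> t \<omega>) \<theta>\<^sub>1 \<theta>\<^sub>2) (dq3 (\<sigma> t \<omega>) \<theta>\<^sub>1 \<theta>\<^sub>2)
       (dq1 (f t \<omega>) \<theta>\<^sub>1 \<theta>\<^sub>2) (dq2 (f t \<omega>) \<theta>\<^sub>1 \<theta>\<^sub>2) (dq3 (f t \<omega>) \<theta>\<^sub>1 \<theta>\<^sub>2) y"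
  by (simp add: F_fun_def riccati_def Let_def)

text \<open>The generators are events of \<open>B\<close> at nonnegative times and null sets, all
  measurable in \<open>M\<close>. The inclusion of sigma-algebras is phrased through the identity
  map so that it can be composed.\<close>

lemma augmented_filtration_id_measurable:
  assumes "brownian_motion M B"
  shows "(\<lambda>\<omega>. \<omega>) \<in> measurable M (augmented_filtration M B t)"
  unfolding augmented_filtration_def
proof (rule measurable_sigma_sets)
  let ?A = "{B s -` A \<inter> space M | s A. s \<in> {0..t} \<and> A \<in> sets borel} \<union> null_sets M"
  show sub: "?A \<subseteq> Pow (space M)" using sets.sets_into_space by fastforce
  show "sets (sigma (space M) ?A) = sigma_sets (space M) ?A" by (rule sets_measure_of[OF sub])
  fix X assume "X \<in> ?A"
  moreover have "B s \<in> borel_measurable M" if "0 \<le> s" for s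
    using assms that by (simp add: brownian_motion_def)
  ultimately have "X \<in> sets M" by (auto intro: measurable_sets)
  then show "(\<lambda>\<omega>. \<omega>) -` X \<inter> space M \<in> sets M" by simp
qed auto

text \<open>Progressive measurability at the final time is joint measurability, and the filtration
  may then be enlarged to \<open>M\<close>.\<close>

lemma progressively_measurable_pair:
  assumes "brownian_motion M B" and "progressively_measurable T (augmented_filtration M B) X" and "0 \<le> T"
  shows "(\<lambda>q. X (fst q) (snd q)) \<in> borel_measurable (restrict_space borel {0..T} \<Otimes>\<^sub>M M)"
proof -
  have X: "(\<lambda>(s, \<omega>). X s \<omega>)
      \<in> borel_measurable (restrict_space borel {0..T} \<Otimes>\<^sub>M augmented_filtration M B T)"
    using assms by (simp add: progressively_measurable_def)
  have "(\<lambda>q. (fst q, snd q)) \<in> measurable (restrict_space borel {0..T} \<Otimes>\<^sub>M M)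
      (restrict_space borel {0..T} \<Otimes>\<^sub>M augmented_filtration M B T)"
    by (intro measurable_Pair measurable_fst
        measurable_compose[OF measurable_snd augmented_filtration_id_measurable[OF assms(1)]])
  from measurable_compose[OF this X] show ?thesis by simp
qed

text \<open>The quotients of \<open>b\<close> and \<open>f\<close> and the first two of \<sigma> are
  bounded by \<open>K\<close>, but the third of \<sigma> by \<open>c\<^sub>1\<close>: this is what
  bounds the denominator below by \<open>1 - c\<^sub>1 * c\<close>. Both constants depend on
  \<open>K\<close>, \<open>c\<^sub>1\<close> and \<open>c\<close> only.\<close>

lemma F_fun_lipschitz_family:
  fixes M :: "'w measure"
  assumes B: "brownian_motion M B" and A: "standing_assumption T K M B b \<sigma> f g"
    and \<sigma>\<^sub>3: "\<forall>t\<in>{0..T}. \<forall>\<omega>\<in>space M. \<forall>\<theta>\<^sub>1 \<theta>\<^sub>2. \<bar>dq3 (\<sigma> t \<omega>) \<theta>\<^sub>1 \<theta>\<^sub>2\<bar> \<le> c\<^sub>1"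
    and pos: "0 \<le> T" "0 < K" "0 < c\<^sub>1" "0 < c" "c\<^sub>1 * c < 1"
  shows "lipschitz_family M (\<lambda>t \<omega> y p. F_fun b \<sigma> f (fst p) (snd p) t \<omega> y) distinct_triples T c
    (riccati_bound K c\<^sub>1 c) (riccati_lip K c\<^sub>1 c)"
proof -
  interpret prob_space M using B by (simp add: brownian_motion_def)
  have lip: "K-lipschitz_on UNIV (b t \<omega>)" "K-lipschitz_on UNIV (\<sigma> t \<omega>)" "K-lipschitz_on UNIV (f t \<omega>)"
    if "t \<in> {0..T}" "\<omega> \<in> space M" for t \<omega>
    using A that by (auto simp: standing_assumption_def)
  have m: "(\<lambda>q. b (fst q) (snd q) \<theta>) \<in> borel_measurable (restrict_space borel {0..T} \<Otimes>\<^sub>M M)"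
    "(\<lambda>q. \<sigma> (fst q) (snd q) \<theta>) \<in> borel_measurable (restrict_space borel {0..T} \<Otimes>\<^sub>M M)"
    "(\<lambda>q. f (fst q) (snd q) \<theta>) \<in> borel_measurable (restrict_space borel {0..T} \<Otimes>\<^sub>M M)" for \<theta>
    by (rule progressively_measurable_pair[OF B _ pos(1)]; use A in \<open>unfold standing_assumption_def, blast\<close>)+
  show ?thesis
  proof unfold_locales
    show "0 < riccati_lip K c\<^sub>1 c" using pos by (intro riccati_lip_pos)
    show "open distinct_triples" by (rule open_distinct_triples)
    have "((0, 0, 0), (1, 1, 1)) \<in> distinct_triples" by (simp add: distinct_triples_def)
    then show "distinct_triples \<noteq> {}" by blast
  next
    fix t \<omega> y assume t: "t \<in> {0..T}" "\<omega> \<in> space M" and y: "\<bar>y\<bar> \<le> c"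
    have nz: "1 - dq3 (\<sigma> t \<omega>) \<theta>\<^sub>1 \<theta>\<^sub>2 * y \<noteq> 0" for \<theta>\<^sub>1 \<theta>\<^sub>2
    proof -
      have "\<bar>dq3 (\<sigma> t \<omega>) \<theta>\<^sub>1 \<theta>\<^sub>2\<bar> \<le> c\<^sub>1" using \<sigma>\<^sub>3 t by blast
      from abs_mult_le[OF this y] show ?thesis using pos by linarith
    qed
    show "continuous_on distinct_triples (\<lambda>p. F_fun b \<sigma> f (fst p) (snd p) t \<omega> y)"
      unfolding F_fun_eq_riccati riccati_def
      by (intro continuous_intros continuous_on_dq lipschitz_on_continuous_on[OF lip(1)[OF t]]
          lipschitz_on_continuous_on[OF lip(2)[OF t]] lipschitz_on_continuous_on[OF lip(3)[OF t]])
        (use nz in auto)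
  next
    fix p y assume p: "p \<in> distinct_triples"
    have "(\<lambda>q. F_fun b \<sigma> f (fst p) (snd p) (fst q) (snd q) y)
        \<in> borel_measurable (restrict_space borel {0..T} \<Otimes>\<^sub>M M)"
      unfolding F_fun_eq_riccati riccati_def
      by (intro borel_measurable_add borel_measurable_times borel_measurable_divide borel_measurable_diff
          borel_measurable_const borel_measurable_dq[OF m(1) p] borel_measurable_dq[OF m(2) p]
          borel_measurable_dq[OF m(3) p])
    then show "(\<lambda>(t, \<omega>). F_fun b \<sigma> f (fst p) (snd p) t \<omega> y)
        \<in> borel_measurable (restrict_space borel {0..T} \<Otimes>\<^sub>M M)"
      by (simp add: case_prod_beta')
  next
    fix t \<omega> y and p :: "(real \<times> real \<times> real) \<times> (real \<times> real \<times> real)"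
    assume t: "t \<in> {0..T}" "\<omega> \<in> space M" and y: "\<bar>y\<bar> \<le> c" and "p \<in> distinct_triples"
    then have p: "(fst p, snd p) \<in> distinct_triples" by simp
    have s: "\<bar>dq3 (\<sigma> t \<omega>) (fst p) (snd p)\<bar> \<le> c\<^sub>1" using \<sigma>\<^sub>3 t by blast
    note bnd = dq_lipschitz_bound[OF lip(1)[OF t] p] dq_lipschitz_bound(1,2)[OF lip(2)[OF t] p]
      dq_lipschitz_bound[OF lip(3)[OF t] p] s pos(5)
    show "\<bar>F_fun b \<sigma> f (fst p) (snd p) t \<omega> y\<bar> \<le> riccati_bound K c\<^sub>1 c"
      unfolding F_fun_eq_riccati by (intro riccati_bounded bnd y)
    fix y' assume y': "\<bar>y'\<bar> \<le> c"
    show "\<bar>F_fun b \<sigma> f (fst p) (snd p) t \<omega> y - F_fun b \<sigma> f (fst p) (snd p) t \<omega> y'\<bar>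
        \<le> riccati_lip K c\<^sub>1 c * \<bar>y - y'\<bar>"
      unfolding F_fun_eq_riccati by (intro riccati_lipschitz bnd y y')
  qed (use pos in auto)
qed

section \<open>Terminal values of the dominating equations\<close>

lemma essinf_INF_eq:
  "essinf M (\<lambda>\<omega>. INF p\<in>S. ereal (X \<omega> p)) = - esssup M (\<lambda>\<omega>. SUP p\<in>S. ereal (- X \<omega> p))"
  by (simp add: essinf_def ereal_SUP_uminus_eq flip: uminus_ereal.simps)

text \<open>The reduction to countably many pairs, used for \<open>F\<close> above, makes the
  extreme slopes of \<open>g\<close> measurable; their essential bounds are then finite because
  every slope lies in \<open>[-c, c]\<close>.\<close>

lemma terminal_slopes:
  fixes M :: "'w measure"
  assumes B: "brownian_motion M B" and A: "standing_assumption T K M B b \<sigma> f g"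
    and h: "\<forall>\<omega>\<in>space M. \<forall>x\<^sub>1 x\<^sub>2. \<bar>diff_quot (\<lambda>x. g x \<omega>) x\<^sub>1 x\<^sub>2\<bar> \<le> c"
  obtains h\<^sub>1 h\<^sub>2 where "h_lower M g = ereal h\<^sub>1" "h_upper M g = ereal h\<^sub>2" "h\<^sub>1 \<le> h\<^sub>2" "- c \<le> h\<^sub>1" "h\<^sub>2 \<le> c"
proof -
  interpret prob_space M using B by (simp add: brownian_motion_def)
  define q where "q \<omega> p = diff_quot (\<lambda>x. g x \<omega>) (fst p) (snd p)" for \<omega> p
  define up where "up \<omega> = (SUP p\<in>distinct_pairs. ereal (q \<omega> p))" for \<omega>
  define low where "low \<omega> = (SUP p\<in>distinct_pairs. ereal (- q \<omega> p))" for \<omega>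
  have g_cont: "continuous_on UNIV (\<lambda>x. g x \<omega>)" if "\<omega> \<in> space M" for \<omega>
    using A that by (auto simp: standing_assumption_def intro: lipschitz_on_continuous_on)
  have g_meas: "g x \<in> borel_measurable M" for x
  proof -
    have "g x \<in> borel_measurable (augmented_filtration M B T)"
      using A by (simp add: standing_assumption_def)
    from measurable_compose[OF augmented_filtration_id_measurable[OF B] this] show ?thesis by simp
  qed
  have q_cont: "continuous_on distinct_pairs (q \<omega>)" if "\<omega> \<in> space M" for \<omega>
  proof -
    have "continuous_on distinct_pairs (\<lambda>p. (g (fst p) \<omega> - g (snd p) \<omega>) / (fst p - snd p))"
      by (intro continuous_intros continuous_on_compose2[OF g_cont[OF that]])
        (auto simp: distinct_pairs_def)
    then show ?thesis
      by (rule continuous_on_eq) (auto simp: q_def diff_quot_def distinct_pairs_def)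
  qed
  have q_meas: "(\<lambda>\<omega>. q \<omega> p) \<in> borel_measurable M" if "p \<in> distinct_pairs" for p
  proof -
    have "(\<lambda>\<omega>. (g (fst p) \<omega> - g (snd p) \<omega>) / (fst p - snd p)) \<in> borel_measurable M"
      by (intro borel_measurable_divide borel_measurable_diff borel_measurable_const g_meas)
    moreover have "fst p \<noteq> snd p" using that by (auto simp: distinct_pairs_def)
    ultimately show ?thesis by (simp add: q_def diff_quot_def)
  qed
  have q_bd: "\<bar>q \<omega> p\<bar> \<le> c" if "\<omega> \<in> space M" for \<omega> p using h that by (simp add: q_def)
  \<comment> \<open>A single admissible pair suffices to bound the suprema from below and to order
    the two terminal values.\<close>
  have p01: "(0, 1) \<in> distinct_pairs" by (simp add: distinct_pairs_def)
  have bounds: "ereal (- c) \<le> (SUP p\<in>distinct_pairs. ereal (r p))" "(SUP p\<in>distinct_pairs. ereal (r p)) \<le> ereal c"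
    if "\<And>p. \<bar>r p\<bar> \<le> c" for r
  proof -
    show "ereal (- c) \<le> (SUP p\<in>distinct_pairs. ereal (r p))"
      by (rule SUP_upper2[OF p01]) (use that[of "(0, 1)"] in simp)
    show "(SUP p\<in>distinct_pairs. ereal (r p)) \<le> ereal c"
      by (rule SUP_least) (use that in \<open>simp add: abs_le_iff\<close>)
  qed
  have up_meas: "up \<in> borel_measurable M" unfolding up_def
    by (rule borel_measurable_SUP_continuous[OF open_distinct_pairs q_meas q_cont])
  have low_meas: "low \<in> borel_measurable M" unfolding low_def
    by (intro borel_measurable_SUP_continuous[OF open_distinct_pairs] borel_measurable_uminus q_meas
        continuous_on_minus q_cont)
  have up: "ereal (- c) \<le> esssup M up" "esssup M up \<le> ereal c"
    using esssup_bounds[OF up_meas, of "ereal (- c)" "ereal c"] bounds[of "\<lambda>p. q _ p"] q_bd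
    by (simp_all add: up_def)
  have low: "ereal (- c) \<le> esssup M low" "esssup M low \<le> ereal c"
    using esssup_bounds[OF low_meas, of "ereal (- c)" "ereal c"] bounds[of "\<lambda>p. - q _ p"] q_bd
    by (simp_all add: low_def)
  have order: "- esssup M low \<le> esssup M up"
  proof (rule esssup_uminus_ge)
    fix \<omega>
    have "- low \<omega> \<le> - ereal (- q \<omega> (0, 1))"
      unfolding low_def ereal_minus_le_minus using p01 by (rule SUP_upper)
    also have "\<dots> = ereal (q \<omega> (0, 1))" by simp
    also have "\<dots> \<le> up \<omega>" unfolding up_def using p01 by (rule SUP_upper)
    finally show "- low \<omega> \<le> up \<omega>" .
  qed
  obtain u where u: "esssup M up = ereal u" using up by (cases "esssup M up") auto
  obtain l where l: "esssup M low = ereal l" using low by (cases "esssup M low") auto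
  show ?thesis
  proof (rule that)
    show "h_upper M g = ereal u"
      unfolding u[symmetric] h_upper_def up_def q_def by (simp add: case_prod_beta')
    have "h_lower M g = - esssup M low"
      unfolding h_lower_def low_def essinf_INF_eq[symmetric] q_def by (simp add: case_prod_beta')
    then show "h_lower M g = ereal (- l)" by (simp add: l)
  qed (use up low order u l in auto)
qed

section \<open>Bounds along the solutions and the choice of the threshold\<close>

text \<open>The product of the quotient and \<open>y t\<close> is at most
  \<open>c\<^sub>1 * c < 1\<close> in absolute value, so \<open>inverse (1 - c\<^sub>1 * c)\<close>
  is a bound uniform in time, \<omega> and both points.\<close>

lemma bounded_with_inverseI:
  assumes \<sigma>\<^sub>3: "\<forall>t\<in>{0..T}. \<forall>\<omega>\<in>space M. \<forall>\<theta>\<^sub>1 \<theta>\<^sub>2. \<bar>dq3 (\<sigma> t \<omega>) \<theta>\<^sub>1 \<theta>\<^sub>2\<bar> \<le> c\<^sub>1"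
    and d: "c\<^sub>1 * c < 1" and y: "\<And>t. t \<in> {0..T} \<Longrightarrow> \<bar>y t\<bar> \<le> c"
  shows "bounded_with_inverse T M \<sigma> y"
  unfolding bounded_with_inverse_def
proof (intro conjI exI ballI allI)
  show "bounded (y ` {0..T})" using y by (intro boundedI[where B = c]) auto
  fix t \<omega> \<theta>\<^sub>1 \<theta>\<^sub>2 assume t: "t \<in> {0..T}" "\<omega> \<in> space M"
  let ?D = "1 - dq3 (\<sigma> t \<omega>) \<theta>\<^sub>1 \<theta>\<^sub>2 * y t"
  have "\<bar>dq3 (\<sigma> t \<omega>) \<theta>\<^sub>1 \<theta>\<^sub>2\<bar> \<le> c\<^sub>1" using \<sigma>\<^sub>3 t by blast
  from abs_mult_le[OF this y[OF t(1)]] have D: "1 - c\<^sub>1 * c \<le> ?D" "0 < ?D" using d by linarith+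
  then show "?D \<noteq> 0" by simp
  show "\<bar>inverse ?D\<bar> \<le> inverse (1 - c\<^sub>1 * c)" using D d by (simp add: le_imp_inverse_le)
qed

theorem theorem5p9:
  fixes T c\<^sub>1 c\<^sub>2 c\<^sub>3 K\<^sub>0 :: real
  assumes "T > 0" and "c\<^sub>1 > 0" and "0 < c\<^sub>2" and "c\<^sub>2 < c\<^sub>3" and "c\<^sub>1 * c\<^sub>3 < 1" and "K\<^sub>0 > 0"
  shows "\<exists>\<epsilon>\<^sub>0>0. \<forall>\<epsilon>. 0 < \<epsilon> \<and> \<epsilon> \<le> \<epsilon>\<^sub>0 \<longrightarrow>
    (\<forall>(M :: 'w measure) B b \<sigma> f g.
       brownian_motion M B \<longrightarrow>
       standing_assumption T K\<^sub>0 M B b \<sigma> f g \<longrightarrow>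
       (\<forall>t\<in>{0..T}. \<forall>\<omega>\<in>space M. \<forall>\<theta>\<^sub>1 \<theta>\<^sub>2. \<bar>dq3 (\<sigma> t \<omega>) \<theta>\<^sub>1 \<theta>\<^sub>2\<bar> \<le> c\<^sub>1) \<longrightarrow>
       (\<forall>\<omega>\<in>space M. \<forall>x\<^sub>1 x\<^sub>2. \<bar>diff_quot (\<lambda>x. g x \<omega>) x\<^sub>1 x\<^sub>2\<bar> \<le> c\<^sub>2) \<longrightarrow>
       (\<forall>t\<in>{0..T}. F_upper M b \<sigma> f t c\<^sub>3 \<le> ereal \<epsilon>) \<longrightarrow>
       (\<forall>t\<in>{0..T}. F_lower M b \<sigma> f t (- c\<^sub>3) \<ge> ereal (- \<epsilon>)) \<longrightarrow>
       (\<exists>y_up y_low.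
          ode_solution T (h_upper M g) (F_upper M b \<sigma> f) y_up \<and>
          ode_solution T (h_lower M g) (F_lower M b \<sigma> f) y_low \<and>
          (\<forall>t\<in>{0..T}. - c\<^sub>3 \<le> y_low t \<and> y_low t \<le> y_up t \<and> y_up t \<le> c\<^sub>3) \<and>
          bounded_with_inverse T M \<sigma> y_up \<and>
          bounded_with_inverse T M \<sigma> y_low))"
proof (intro exI[of _ "riccati_lip K\<^sub>0 c\<^sub>1 c\<^sub>3 * (c\<^sub>3 - c\<^sub>2) * exp (- (2 * riccati_lip K\<^sub>0 c\<^sub>1 c\<^sub>3 * T))"]
    conjI allI impI)
  have c\<^sub>3: "0 < c\<^sub>3" using assms by simp
  have "0 < riccati_lip K\<^sub>0 c\<^sub>1 c\<^sub>3" using assms c\<^sub>3 by (intro riccati_lip_pos)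
  \<comment> \<open>The threshold is \<open>L\<close> times the barrier at time 0, with
    \<open>L\<close> the constant \<open>riccati_lip\<close> and the barrier running from
    \<open>c\<^sub>2\<close> to \<open>c\<^sub>3\<close>. It is fixed before the probability space
    and the coefficients are chosen.\<close>
  then show "0 < riccati_lip K\<^sub>0 c\<^sub>1 c\<^sub>3 * (c\<^sub>3 - c\<^sub>2) * exp (- (2 * riccati_lip K\<^sub>0 c\<^sub>1 c\<^sub>3 * T))"
    using assms by simp
  fix \<epsilon> and M :: "'w measure" and B b \<sigma> f g
  assume \<epsilon>: "0 < \<epsilon> \<and> \<epsilon> \<le> riccati_lip K\<^sub>0 c\<^sub>1 c\<^sub>3 * (c\<^sub>3 - c\<^sub>2) * exp (- (2 * riccati_lip K\<^sub>0 c\<^sub>1 c\<^sub>3 * T))"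
    and B: "brownian_motion M B" and A: "standing_assumption T K\<^sub>0 M B b \<sigma> f g"
    and \<sigma>\<^sub>3: "\<forall>t\<in>{0..T}. \<forall>\<omega>\<in>space M. \<forall>\<theta>\<^sub>1 \<theta>\<^sub>2. \<bar>dq3 (\<sigma> t \<omega>) \<theta>\<^sub>1 \<theta>\<^sub>2\<bar> \<le> c\<^sub>1"
    and h: "\<forall>\<omega>\<in>space M. \<forall>x\<^sub>1 x\<^sub>2. \<bar>diff_quot (\<lambda>x. g x \<omega>) x\<^sub>1 x\<^sub>2\<bar> \<le> c\<^sub>2"
    and top: "\<forall>t\<in>{0..T}. F_upper M b \<sigma> f t c\<^sub>3 \<le> ereal \<epsilon>"
    and bot: "\<forall>t\<in>{0..T}. F_lower M b \<sigma> f t (- c\<^sub>3) \<ge> ereal (- \<epsilon>)"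
  interpret F: lipschitz_family M "\<lambda>t \<omega> y p. F_fun b \<sigma> f (fst p) (snd p) t \<omega> y" distinct_triples T c\<^sub>3
    "riccati_bound K\<^sub>0 c\<^sub>1 c\<^sub>3" "riccati_lip K\<^sub>0 c\<^sub>1 c\<^sub>3"
    by (rule F_fun_lipschitz_family[OF B A \<sigma>\<^sub>3]) (use assms c\<^sub>3 in auto)
  \<comment> \<open>The identities hold as equations between functions, so the two dominating
    equations can be rewritten wholesale.\<close>
  have up: "F_upper M b \<sigma> f = F.ess_G"
    by (intro ext) (simp add: F_upper_def F.ess_G_def F.sup_G_def case_prod_beta')
  have low: "F_lower M b \<sigma> f = F.ess_low"
    by (intro ext) (simp add: F_lower_def F.ess_low_def case_prod_beta' essinf_INF_eq)
  obtain h\<^sub>1 h\<^sub>2 where h12: "h_lower M g = ereal h\<^sub>1" "h_upper M g = ereal h\<^sub>2"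
    "h\<^sub>1 \<le> h\<^sub>2" "- c\<^sub>2 \<le> h\<^sub>1" "h\<^sub>2 \<le> c\<^sub>2"
    using terminal_slopes[OF B A h] by blast
  have top': "F.ess_G t c\<^sub>3 \<le> ereal \<epsilon>" and bot': "ereal (- \<epsilon>) \<le> F.ess_low t (- c\<^sub>3)"
    if "t \<in> {0..T}" for t
    using top bot that unfolding up low by auto
  \<comment> \<open>Here \<open>a\<close> is \<open>c\<^sub>2\<close>: the terminal values lie in
    \<open>[-c\<^sub>2, c\<^sub>2]\<close>, strictly inside the strip.\<close>
  obtain y_low y_up where y: "ode_solution T (ereal h\<^sub>2) F.ess_G y_up" "ode_solution T (ereal h\<^sub>1) F.ess_low y_low"
    and order: "\<And>t. t \<in> {0..T} \<Longrightarrow> - c\<^sub>3 \<le> y_low t \<and> y_low t \<le> y_up t \<and> y_up t \<le> c\<^sub>3"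
    using F.two_sided_solutions_exist[OF top' bot' h12(3-5) assms(4) conjunct2[OF \<epsilon>]] by blast
  have "bounded_with_inverse T M \<sigma> y_up" "bounded_with_inverse T M \<sigma> y_low"
    by (rule bounded_with_inverseI[OF \<sigma>\<^sub>3 assms(5)]; use order in fastforce)+
  then show "\<exists>y_up y_low.
      ode_solution T (h_upper M g) (F_upper M b \<sigma> f) y_up \<and>
      ode_solution T (h_lower M g) (F_lower M b \<sigma> f) y_low \<and>
      (\<forall>t\<in>{0..T}. - c\<^sub>3 \<le> y_low t \<and> y_low t \<le> y_up t \<and> y_up t \<le> c\<^sub>3) \<and>
      bounded_with_inverse T M \<sigma> y_up \<and> bounded_with_inverse T M \<sigma> y_low"
    unfolding up low h12(1,2) using y order by blast
qed

end
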